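(* Let $(M,\omega)$ be a closed, connected symplectic manifold and let $\{\phi_t^H\}$, $t\in[0,1]$, be a nonconstant loop in $\mathrm{Ham}(M,\omega)$ based at $\mathrm{Id}$. If $x_0\in M$ is a fixed global maximum of $H_t$, then $D\phi_t^H(x_0)\neq \mathrm{Id}$ for some value of $t$.
   Context: $H_t: M\to\mathbb{R}$, $t\in[0,1]$, is a smooth family of functions; $X_t^H$ is defined by $\omega(X_t^H,\cdot)=dH_t$ and $\phi_t^H$ is the corresponding flow with $\phi_0^H=\mathrm{Id}$. It is a loop if $\phi_1^H=\mathrm{Id}$. $\mathrm{Ham}(M,\omega)$ is the group of Hamiltonian diffeomorphisms. A point $x_0\in M$ is a fixed global maximum of $H_t$ if $H_t(x_0)\ge H_t(y)$ for all $t\in[0,1]$ and all $y\in M$. Such a point satisfies $\phi_t^H(x_0)=x_0$ for all $t$. *)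

theory Defs
  imports "HOL-Analysis.Analysis"
begin

section \<open>Smooth functions on subsets of Euclidean space\<close>

text \<open>\<open>Ck_on k f U\<close> is meant for open \<open>U\<close>: all iterated directional derivatives of \<open>f\<close> of order
  at most \<open>k\<close> exist and are continuous on \<open>U\<close>.\<close>

primrec Ck_on ::
  "nat \<Rightarrow> ('a::euclidean_space \<Rightarrow> 'b::euclidean_space) \<Rightarrow> 'a set \<Rightarrow> bool" where
  "Ck_on 0 f U \<longleftrightarrow> continuous_on U f"
| "Ck_on (Suc k) f U \<longleftrightarrow>
     (\<forall>x\<in>U. f differentiable (at x)) \<and>
     (\<forall>v. Ck_on k (\<lambda>x. frechet_derivative f (at x) v) U)"

text \<open>On an arbitrary set \<open>S\<close>, such as \<open>[0,1] \<times> V\<close>, a function is smooth if near each point of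
  \<open>S\<close> it extends to a smooth function on an open set.\<close>

definition smooth_on :: "'a::euclidean_space set \<Rightarrow> ('a \<Rightarrow> 'b::euclidean_space) \<Rightarrow> bool" where
  "smooth_on S f \<longleftrightarrow>
     (\<forall>x\<in>S. \<exists>U g. open U \<and> x \<in> U \<and> (\<forall>k. Ck_on k g U) \<and> (\<forall>y\<in>U \<inter> S. g y = f y))"


section \<open>Smooth manifolds\<close>

text \<open>A manifold is the universe of a Hausdorff, second countable type \<open>'m\<close> with a smooth atlas
  modelled on \<open>'e\<close>. A chart is a pair of a domain and a coordinate map; the values of the
  coordinate map outside the domain carry no meaning. The atlas need not be maximal.\<close>

type_synonym ('m, 'e) chart = "'m set \<times> ('m \<Rightarrow> 'e)"

abbreviation cdom :: "('m, 'e) chart \<Rightarrow> 'm set" where "cdom \<equiv> fst"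
abbreviation coord :: "('m, 'e) chart \<Rightarrow> 'm \<Rightarrow> 'e" where "coord \<equiv> snd"
abbreviation cimage :: "('m, 'e) chart \<Rightarrow> 'e set" where "cimage C \<equiv> coord C ` cdom C"
abbreviation param :: "('m, 'e) chart \<Rightarrow> 'e \<Rightarrow> 'm" where "param C \<equiv> inv_into (cdom C) (coord C)"

definition smooth_atlas ::
  "('m::{t2_space, second_countable_topology}, 'e::euclidean_space) chart set \<Rightarrow> bool" where
  "smooth_atlas A \<longleftrightarrow>
     (\<Union>C\<in>A. cdom C) = UNIV \<and>
     (\<forall>C\<in>A. open (cdom C) \<and> open (cimage C) \<and>
        homeomorphism (cdom C) (cimage C) (coord C) (param C)) \<and>
     (\<forall>C\<in>A. \<forall>D\<in>A. smooth_on (coord C ` (cdom C \<inter> cdom D)) (coord D \<circ> param C))"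

definition chart_at :: "('m, 'e) chart set \<Rightarrow> 'm \<Rightarrow> ('m, 'e) chart" where
  "chart_at A x = (SOME C. C \<in> A \<and> x \<in> cdom C)"

definition transition_deriv ::
  "('m, 'e::euclidean_space) chart \<Rightarrow> ('m, 'e) chart \<Rightarrow> 'm \<Rightarrow> 'e \<Rightarrow> 'e" where
  "transition_deriv C D x = frechet_derivative (coord D \<circ> param C) (at (coord C x))"

text \<open>A tangent vector at \<open>x\<close> is the family of its coordinate representations in the charts
  around \<open>x\<close>, related by the derivatives of the transition maps. At all other arguments the family
  is set to 0, so that equality of functions is equality of tangent vectors.\<close>

type_synonym ('m, 'e) tvec = "('m, 'e) chart \<Rightarrow> 'e"

definition tangent_space ::
  "('m, 'e::euclidean_space) chart set \<Rightarrow> 'm \<Rightarrow> ('m, 'e) tvec set" where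
  "tangent_space A x =
     {v. (\<forall>C\<in>A. \<forall>D\<in>A. x \<in> cdom C \<longrightarrow> x \<in> cdom D \<longrightarrow> v D = transition_deriv C D x (v C)) \<and>
         (\<forall>C. \<not> (C \<in> A \<and> x \<in> cdom C) \<longrightarrow> v C = 0)}"

text \<open>The tangent vector at \<open>x\<close> whose representation in the chart \<open>C\<close> is \<open>u\<close>.\<close>

definition coord_vector ::
  "('m, 'e::euclidean_space) chart set \<Rightarrow> ('m, 'e) chart \<Rightarrow> 'm \<Rightarrow> 'e \<Rightarrow> ('m, 'e) tvec" where
  "coord_vector A C x u =
     (\<lambda>D. if D \<in> A \<and> x \<in> cdom D then transition_deriv C D x u else 0)"

definition tangent_map ::
  "('m, 'e::euclidean_space) chart set \<Rightarrow> ('m \<Rightarrow> 'm) \<Rightarrow> 'm \<Rightarrow> ('m, 'e) tvec \<Rightarrow> ('m, 'e) tvec" where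
  "tangent_map A f x v =
     (let C = chart_at A x in
      (\<lambda>D. if D \<in> A \<and> f x \<in> cdom D
           then frechet_derivative (coord D \<circ> f \<circ> param C) (at (coord C x)) (v C) else 0))"

definition differential ::
  "('m, 'e::euclidean_space) chart set \<Rightarrow> ('m \<Rightarrow> real) \<Rightarrow> 'm \<Rightarrow> ('m, 'e) tvec \<Rightarrow> real" where
  "differential A h x v =
     (let C = chart_at A x in frechet_derivative (h \<circ> param C) (at (coord C x)) (v C))"

text \<open>Velocity at time \<open>t\<close> of a curve defined on \<open>[0,1]\<close>, one-sided at the end points.\<close>

definition velocity ::
  "('m, 'e::euclidean_space) chart set \<Rightarrow> (real \<Rightarrow> 'm) \<Rightarrow> real \<Rightarrow> ('m, 'e) tvec" where
  "velocity A \<gamma> t =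
     (\<lambda>D. if D \<in> A \<and> \<gamma> t \<in> cdom D
          then vector_derivative (coord D \<circ> \<gamma>) (at t within {0..1}) else 0)"

definition smooth_family_functions ::
  "('m, 'e::euclidean_space) chart set \<Rightarrow> (real \<Rightarrow> 'm \<Rightarrow> real) \<Rightarrow> bool" where
  "smooth_family_functions A H \<longleftrightarrow>
     (\<forall>C\<in>A. smooth_on ({0..1} \<times> cimage C) (\<lambda>(t, y). H t (param C y)))"

text \<open>Smoothness of the map \<open>(t, x) \<mapsto> \<phi>\<^sub>t(x)\<close> from \<open>[0,1] \<times> M\<close> to \<open>M\<close>.\<close>

definition smooth_family_maps ::
  "('m::topological_space, 'e::euclidean_space) chart set \<Rightarrow> (real \<Rightarrow> 'm \<Rightarrow> 'm) \<Rightarrow> bool" where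
  "smooth_family_maps A \<phi> \<longleftrightarrow>
     continuous_on ({0..1} \<times> UNIV) (\<lambda>(t, x). \<phi> t x) \<and>
     (\<forall>C\<in>A. \<forall>D\<in>A. smooth_on {(t, y). t \<in> {0..1} \<and> y \<in> cimage C \<and> \<phi> t (param C y) \<in> cdom D}
        (\<lambda>(t, y). coord D (\<phi> t (param C y))))"


section \<open>Symplectic forms\<close>

text \<open>A 2-form is a function \<open>\<omega>\<close> of which only the values of \<open>\<omega> x\<close> on tangent vectors at \<open>x\<close>
  matter. \<open>form_in_chart A \<omega> C y\<close> is the pullback of \<open>\<omega>\<close> under \<open>param C\<close> at the point \<open>y\<close>.\<close>

definition form_in_chart ::
  "('m, 'e::euclidean_space) chart set \<Rightarrow> ('m \<Rightarrow> ('m, 'e) tvec \<Rightarrow> ('m, 'e) tvec \<Rightarrow> real)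
    \<Rightarrow> ('m, 'e) chart \<Rightarrow> 'e \<Rightarrow> 'e \<Rightarrow> 'e \<Rightarrow> real" where
  "form_in_chart A \<omega> C y u v =
     \<omega> (param C y) (coord_vector A C (param C y) u) (coord_vector A C (param C y) v)"

definition smooth_two_form ::
  "('m, 'e::euclidean_space) chart set \<Rightarrow> ('m \<Rightarrow> ('m, 'e) tvec \<Rightarrow> ('m, 'e) tvec \<Rightarrow> real) \<Rightarrow> bool" where
  "smooth_two_form A \<omega> \<longleftrightarrow>
     (\<forall>C\<in>A. \<forall>y\<in>cimage C. bilinear (form_in_chart A \<omega> C y) \<and>
        (\<forall>u. form_in_chart A \<omega> C y u u = 0)) \<and>
     (\<forall>C\<in>A. \<forall>u v. smooth_on (cimage C) (\<lambda>y. form_in_chart A \<omega> C y u v))"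

text \<open>The exterior derivative in a chart, evaluated on constant (hence commuting) vector fields.\<close>

definition ext_deriv_in_chart ::
  "('m, 'e::euclidean_space) chart set \<Rightarrow> ('m \<Rightarrow> ('m, 'e) tvec \<Rightarrow> ('m, 'e) tvec \<Rightarrow> real)
    \<Rightarrow> ('m, 'e) chart \<Rightarrow> 'e \<Rightarrow> 'e \<Rightarrow> 'e \<Rightarrow> 'e \<Rightarrow> real" where
  "ext_deriv_in_chart A \<omega> C y u v w =
     frechet_derivative (\<lambda>z. form_in_chart A \<omega> C z v w) (at y) u
   - frechet_derivative (\<lambda>z. form_in_chart A \<omega> C z u w) (at y) v
   + frechet_derivative (\<lambda>z. form_in_chart A \<omega> C z u v) (at y) w"

definition closed_two_form ::
  "('m, 'e::euclidean_space) chart set \<Rightarrow> ('m \<Rightarrow> ('m, 'e) tvec \<Rightarrow> ('m, 'e) tvec \<Rightarrow> real) \<Rightarrow> bool" where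
  "closed_two_form A \<omega> \<longleftrightarrow>
     (\<forall>C\<in>A. \<forall>y\<in>cimage C. \<forall>u v w. ext_deriv_in_chart A \<omega> C y u v w = 0)"

definition nondegenerate_two_form ::
  "('m, 'e::euclidean_space) chart set \<Rightarrow> ('m \<Rightarrow> ('m, 'e) tvec \<Rightarrow> ('m, 'e) tvec \<Rightarrow> real) \<Rightarrow> bool" where
  "nondegenerate_two_form A \<omega> \<longleftrightarrow>
     (\<forall>x. \<forall>u\<in>tangent_space A x. (\<forall>v\<in>tangent_space A x. \<omega> x u v = 0) \<longrightarrow> u = (\<lambda>C. 0))"

definition symplectic_form ::
  "('m, 'e::euclidean_space) chart set \<Rightarrow> ('m \<Rightarrow> ('m, 'e) tvec \<Rightarrow> ('m, 'e) tvec \<Rightarrow> real) \<Rightarrow> bool" where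
  "symplectic_form A \<omega> \<longleftrightarrow>
     smooth_two_form A \<omega> \<and> closed_two_form A \<omega> \<and> nondegenerate_two_form A \<omega>"

definition closed_connected_symplectic_manifold ::
  "('m::{t2_space, second_countable_topology}, 'e::euclidean_space) chart set
    \<Rightarrow> ('m \<Rightarrow> ('m, 'e) tvec \<Rightarrow> ('m, 'e) tvec \<Rightarrow> real) \<Rightarrow> bool" where
  "closed_connected_symplectic_manifold A \<omega> \<longleftrightarrow>
     smooth_atlas A \<and> compact (UNIV :: 'm set) \<and> connected (UNIV :: 'm set) \<and> symplectic_form A \<omega>"


section \<open>Hamiltonian flows\<close>

definition hamiltonian_vector_field ::
  "('m, 'e::euclidean_space) chart set \<Rightarrow> ('m \<Rightarrow> ('m, 'e) tvec \<Rightarrow> ('m, 'e) tvec \<Rightarrow> real)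
    \<Rightarrow> ('m \<Rightarrow> real) \<Rightarrow> 'm \<Rightarrow> ('m, 'e) tvec" where
  "hamiltonian_vector_field A \<omega> h x =
     (THE X. X \<in> tangent_space A x \<and> (\<forall>v\<in>tangent_space A x. \<omega> x X v = differential A h x v))"

text \<open>For a smooth family \<open>H\<close>, joint smoothness of the integral curves in time and initial point is
  automatic by ODE theory; here it is part of the notion of flow.\<close>

definition hamiltonian_flow ::
  "('m::topological_space, 'e::euclidean_space) chart set
    \<Rightarrow> ('m \<Rightarrow> ('m, 'e) tvec \<Rightarrow> ('m, 'e) tvec \<Rightarrow> real)
    \<Rightarrow> (real \<Rightarrow> 'm \<Rightarrow> real) \<Rightarrow> (real \<Rightarrow> 'm \<Rightarrow> 'm) \<Rightarrow> bool" where
  "hamiltonian_flow A \<omega> H \<phi> \<longleftrightarrow>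
     smooth_family_maps A \<phi> \<and> \<phi> 0 = id \<and>
     (\<forall>t\<in>{0..1}. \<forall>x. velocity A (\<lambda>s. \<phi> s x) t = hamiltonian_vector_field A \<omega> (H t) (\<phi> t x))"

definition Ham ::
  "('m::topological_space, 'e::euclidean_space) chart set
    \<Rightarrow> ('m \<Rightarrow> ('m, 'e) tvec \<Rightarrow> ('m, 'e) tvec \<Rightarrow> real) \<Rightarrow> ('m \<Rightarrow> 'm) set" where
  "Ham A \<omega> = {\<psi>. \<exists>H \<phi>. smooth_family_functions A H \<and> hamiltonian_flow A \<omega> H \<phi> \<and> \<psi> = \<phi> 1}"

text \<open>That \<open>\<phi> t\<close> lies in \<open>Ham A \<omega>\<close> for each \<open>t\<close> also follows from the first conjunct:
  \<open>s \<mapsto> \<phi> (s * t)\<close> is the flow of \<open>s \<mapsto> t * H (s * t)\<close>.\<close>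

definition hamiltonian_loop ::
  "('m::topological_space, 'e::euclidean_space) chart set
    \<Rightarrow> ('m \<Rightarrow> ('m, 'e) tvec \<Rightarrow> ('m, 'e) tvec \<Rightarrow> real)
    \<Rightarrow> (real \<Rightarrow> 'm \<Rightarrow> real) \<Rightarrow> (real \<Rightarrow> 'm \<Rightarrow> 'm) \<Rightarrow> bool" where
  "hamiltonian_loop A \<omega> H \<phi> \<longleftrightarrow>
     hamiltonian_flow A \<omega> H \<phi> \<and> (\<forall>t\<in>{0..1}. \<phi> t \<in> Ham A \<omega>) \<and> \<phi> 1 = id"

definition fixed_global_maximum :: "(real \<Rightarrow> 'm \<Rightarrow> real) \<Rightarrow> 'm \<Rightarrow> bool" where
  "fixed_global_maximum H x \<longleftrightarrow> (\<forall>t\<in>{0..1}. \<forall>y. H t x \<ge> H t y)"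

end

theory Submission
  imports Defs
begin

text \<open>
  Suppose that the linearized flow at the fixed maximum \<open>x\<^sub>0\<close> is the identity at all times. Its time
  derivative vanishes, which says that the Hessian of every \<open>H t\<close> is zero at \<open>x\<^sub>0\<close>
  (\<open>flat_of_identity_linearization\<close>). The claim is that such a flat maximum propagates over the
  whole manifold, so that every \<open>H t\<close> is constant and the loop is trivial.

  The local step is an elementary comparison of action and area. All orbits \<open>\<gamma>\<close> of the loop are closed,
  and the symplectic action is constant along a family of closed orbits. Measured from the constant
  orbit at \<open>x\<^sub>0\<close>, and with \<open>k t = H t x\<^sub>0 - H t \<ge> 0\<close>, this says that \<open>\<integral> k t (\<gamma> t) dt\<close> equals the
  symplectic area of a cone over \<open>\<gamma>\<close> (\<open>action_balance\<close>), which follows from closedness of the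
  symplectic form in the shape of \<open>cone_area_deriv\<close>. The area is at most a constant times
  \<open>\<integral> |\<gamma>'|\<^sup>2 dt\<close> (\<open>cone_area_bound\<close>). On the other hand \<open>|\<gamma>'|\<close> is bounded by the gradient of \<open>k t\<close>, and
  a nonnegative function whose second derivatives are at most of order \<open>\<epsilon>\<close> satisfies
  \<open>|grad k|\<^sup>2 \<le> 4 \<epsilon> k\<close> (\<open>gradient_square_le\<close>). Near a flat maximum \<open>\<epsilon>\<close> is as small as desired, hence
  \<open>\<integral> k \<le> const \<cdot> \<epsilon> \<integral> k\<close> forces \<open>k = 0\<close> along all nearby orbits (\<open>semidefinite_loop_rigidity\<close>,
  \<open>maximum_set_open_at_flat_point\<close>).

  The interior of the set on which every \<open>H t\<close> is maximal is therefore nonempty. It is also closed,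
  since at its boundary points the second derivatives vanish by continuity and the local step
  applies again. The manifold is connected, so every point is a fixed maximum. Fixed maxima are
  fixed points of the flow by uniqueness of solutions (\<open>maximum_is_fixed\<close>), and the loop is constant
  (\<open>trivial_if_flat_maximum\<close>).
\<close>

section \<open>Calculus on a cylinder over an open set\<close>

text \<open>The derivatives of a family \<open>f\<close> on \<open>[0,1] \<times> V\<close> in the two kinds of directions. The time
  derivative is one-sided at 0 and 1, where \<open>f\<close> carries no information beyond the cylinder.\<close>

definition space_deriv ::
  "'a::euclidean_space \<Rightarrow> (real \<times> 'a \<Rightarrow> 'b::euclidean_space) \<Rightarrow> real \<times> 'a \<Rightarrow> 'b" where
  "space_deriv v f = (\<lambda>(t, y). frechet_derivative (\<lambda>z. f (t, z)) (at y) v)"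

definition time_deriv ::
  "(real \<times> 'a::euclidean_space \<Rightarrow> 'b::euclidean_space) \<Rightarrow> real \<times> 'a \<Rightarrow> 'b" where
  "time_deriv f = (\<lambda>(t, y). vector_derivative (\<lambda>s. f (s, y)) (at t within {0..1}))"

lemma smooth_on_subset: "smooth_on S f \<Longrightarrow> T \<subseteq> S \<Longrightarrow> smooth_on T f"
  unfolding smooth_on_def by (meson IntD1 IntD2 IntI subsetD)

lemma Ck_on_imp_continuous_on: "Ck_on k f U \<Longrightarrow> continuous_on U f"
  by (cases k) (simp_all add: differentiable_imp_continuous_on differentiable_at_imp_differentiable_on)

lemma smooth_on_imp_continuous_on:
  assumes "smooth_on S f" shows "continuous_on S f"
  unfolding continuous_on_eq_continuous_within
proof
  fix x assume "x \<in> S"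
  then obtain U g where U: "open U" "x \<in> U" "\<forall>k. Ck_on k g U" "\<forall>y\<in>U \<inter> S. g y = f y"
    using assms unfolding smooth_on_def by meson
  have "continuous_on (U \<inter> S) g"
    using Ck_on_imp_continuous_on U(3) continuous_on_subset by blast
  then have "continuous_on (S \<inter> U) f"
    using U(4) by (metis Int_commute continuous_on_cong)
  then have "continuous (at x within S \<inter> U) f"
    using U(2) \<open>x \<in> S\<close> by (simp add: continuous_on_eq_continuous_within)
  then show "continuous (at x within S) f"
    using at_within_nhd[OF U(2,1), of S "S \<inter> U"] by (simp add: continuous_within Int_assoc)
qed

lemma smooth_on_open_has_derivative:
  assumes "smooth_on S f" "open S" "x \<in> S"
  shows "(f has_derivative frechet_derivative f (at x)) (at x)"
proof -
  obtain U g where U: "open U" "x \<in> U" "\<forall>k. Ck_on k g U" "\<forall>y\<in>U \<inter> S. g y = f y"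
    using assms unfolding smooth_on_def by meson
  have "Ck_on (Suc 0) g U" using U(3) by blast
  then have "g differentiable (at x)"
    using U(2) by simp
  then have "(g has_derivative frechet_derivative g (at x)) (at x)"
    by (simp add: frechet_derivative_works[symmetric])
  then have "(f has_derivative frechet_derivative g (at x)) (at x)"
    by (rule has_derivative_transform_within_open[where s="U \<inter> S"]) (use U assms in auto)
  then show ?thesis
    using frechet_derivative_at by metis
qed

lemma smooth_on_open_frechet_derivative:
  assumes "smooth_on S f" "open S"
  shows "smooth_on S (\<lambda>x. frechet_derivative f (at x) v)"
  unfolding smooth_on_def
proof
  fix x assume "x \<in> S"
  then obtain U g where U: "open U" "x \<in> U" "\<forall>k. Ck_on k g U" "\<forall>y\<in>U \<inter> S. g y = f y"
    using assms unfolding smooth_on_def by meson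
  have "frechet_derivative g (at y) v = frechet_derivative f (at y) v" if "y \<in> U \<inter> S" for y
  proof -
    have "Ck_on (Suc 0) g U" using U(3) by blast
    then have "(g has_derivative frechet_derivative g (at y)) (at y)"
      using that by (auto simp: frechet_derivative_works[symmetric])
    then have "(f has_derivative frechet_derivative g (at y)) (at y)"
      by (rule has_derivative_transform_within_open[where s="U \<inter> S"]) (use U assms that in auto)
    then show ?thesis
      using frechet_derivative_at by metis
  qed
  moreover have "\<forall>k. Ck_on k (\<lambda>x. frechet_derivative g (at x) v) U"
    using U(3) Ck_on.simps(2) by blast
  ultimately show "\<exists>U g. open U \<and> x \<in> U \<and> (\<forall>k. Ck_on k g U) \<and>
      (\<forall>y\<in>U \<inter> S. g y = frechet_derivative f (at y) v)"
    using U by blast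
qed

text \<open>The local smooth extension \<open>g\<close> that defines smoothness computes both derivatives of \<open>f\<close>: a
  time slice of the cylinder is open in space, and at the ends of the time interval the derivative
  of \<open>g\<close> restricts to the one-sided derivative of \<open>f\<close>.\<close>

lemma smooth_on_cylinder_local:
  fixes f :: "real \<times> 'a::euclidean_space \<Rightarrow> 'b::euclidean_space"
  assumes f: "smooth_on ({0..1} \<times> V) f" and V: "open V" and ty: "t \<in> {0..1}" "y \<in> V"
  obtains U g where "open U" "(t, y) \<in> U" "\<And>k. Ck_on k g U"
    "\<And>t' y'. (t', y') \<in> U \<Longrightarrow> t' \<in> {0..1} \<Longrightarrow> y' \<in> V \<Longrightarrow>
       ((\<lambda>z. f (t', z)) has_derivative (\<lambda>v. frechet_derivative g (at (t', y')) (0, v))) (at y')"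
    "\<And>t' y'. (t', y') \<in> U \<Longrightarrow> t' \<in> {0..1} \<Longrightarrow> y' \<in> V \<Longrightarrow>
       ((\<lambda>s. f (s, y')) has_vector_derivative frechet_derivative g (at (t', y')) (1, 0))
         (at t' within {0..1})"
proof -
  obtain U g where U: "open U" "(t, y) \<in> U" "\<forall>k. Ck_on k g U"
      "\<forall>p\<in>U \<inter> ({0..1} \<times> V). g p = f p"
    using f ty unfolding smooth_on_def by (metis mem_Sigma_iff)
  have C1: "Ck_on (Suc 0) g U" using U(3) by blast
  have D: "(g has_derivative frechet_derivative g (at p)) (at p)" if "p \<in> U" for p
    using C1 that by (auto simp: frechet_derivative_works[symmetric])
  show thesis
  proof (rule that[OF U(1,2)])
    show "Ck_on k g U" for k using U(3) by blast
    fix t' y' assume A: "(t', y') \<in> U" "t' \<in> {0..1}" "y' \<in> V"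
    have "((\<lambda>z. (t', z)) has_derivative (\<lambda>v. (0, v))) (at y')"
      by (auto intro!: derivative_eq_intros)
    from has_derivative_compose[OF this D[OF A(1)]]
    have *: "((\<lambda>z. g (t', z)) has_derivative (\<lambda>v. frechet_derivative g (at (t', y')) (0, v))) (at y')" .
    have "open ((\<lambda>z. (t', z)) -` U)"
      using U(1) by (intro open_vimage continuous_intros) auto
    then show "((\<lambda>z. f (t', z)) has_derivative (\<lambda>v. frechet_derivative g (at (t', y')) (0, v))) (at y')"
      by (intro has_derivative_transform_within_open[OF *, of "((\<lambda>z. (t', z)) -` U) \<inter> V"])
         (use A V U(4) in auto)
    have "((\<lambda>s. (s, y')) has_vector_derivative (1, 0)) (at t' within {0..1})"
      unfolding has_vector_derivative_def by (auto intro!: derivative_eq_intros)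
    then have *: "((\<lambda>s. g (s, y')) has_vector_derivative frechet_derivative g (at (t', y')) (1, 0)) (at t' within {0..1})"
      using vector_derivative_diff_chain_within[of "\<lambda>s. (s, y')" "(1,0)" t' "{0..1}" g "frechet_derivative g (at (t', y'))"]
        D[OF A(1)] by (simp add: o_def has_derivative_at_withinI)
    have "open ((\<lambda>s. (s, y')) -` U)"
      using U(1) by (intro open_vimage continuous_intros) auto
    then obtain d where d: "d > 0" "ball t' d \<subseteq> (\<lambda>s. (s, y')) -` U"
      using A(1) open_contains_ball by (metis vimageI)
    show "((\<lambda>s. f (s, y')) has_vector_derivative frechet_derivative g (at (t', y')) (1, 0)) (at t' within {0..1})"
      using * unfolding has_vector_derivative_def
    proof (rule has_derivative_transform_within[OF _ d(1) A(2)])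
      fix s assume "s \<in> {0..1}" "dist s t' < d"
      then have "(s, y') \<in> U" using d(2) by (metis dist_commute mem_ball subsetD vimageD)
      then show "g (s, y') = f (s, y')" using U(4) A \<open>s \<in> {0..1}\<close> by auto
    qed
  qed
qed

text \<open>Consequently both derivatives of \<open>f\<close> extend locally to directional derivatives of one smooth
  function. This makes smoothness on the cylinder stable under \<open>space_deriv\<close> and \<open>time_deriv\<close>, so
  that the extensions never appear again.\<close>

lemma smooth_on_cylinder_extension:
  fixes f :: "real \<times> 'a::euclidean_space \<Rightarrow> 'b::euclidean_space"
  assumes f: "smooth_on ({0..1} \<times> V) f" and V: "open V" and ty: "p \<in> {0..1} \<times> V"
  obtains U g where "open U" "p \<in> U" "\<And>k w. Ck_on k (\<lambda>x. frechet_derivative g (at x) w) U"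
    "\<And>q v. q \<in> U \<inter> ({0..1} \<times> V) \<Longrightarrow> frechet_derivative g (at q) (0, v) = space_deriv v f q"
    "\<And>q. q \<in> U \<inter> ({0..1} \<times> V) \<Longrightarrow> frechet_derivative g (at q) (1, 0) = time_deriv f q"
proof -
  obtain t y where p: "p = (t, y)" "t \<in> {0..1}" "y \<in> V" using ty by auto
  from smooth_on_cylinder_local[OF f V p(2,3)] obtain U g where U: "open U" "(t, y) \<in> U" "\<And>k. Ck_on k g U"
    and D: "\<And>t' y'. (t', y') \<in> U \<Longrightarrow> t' \<in> {0..1} \<Longrightarrow> y' \<in> V \<Longrightarrow>
       ((\<lambda>z. f (t', z)) has_derivative (\<lambda>v. frechet_derivative g (at (t', y')) (0, v))) (at y')"
    and T: "\<And>t' y'. (t', y') \<in> U \<Longrightarrow> t' \<in> {0..1} \<Longrightarrow> y' \<in> V \<Longrightarrow>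
       ((\<lambda>s. f (s, y')) has_vector_derivative frechet_derivative g (at (t', y')) (1, 0))
         (at t' within {0..1})" by metis
  show thesis
  proof (rule that[of U g])
    show "open U" "p \<in> U" using U p by auto
    show "Ck_on k (\<lambda>x. frechet_derivative g (at x) w) U" for k w
      using U(3)[of "Suc k"] unfolding Ck_on.simps by blast
    fix q assume "q \<in> U \<inter> ({0..1} \<times> V)"
    then obtain t' y' where q: "q = (t', y')" "(t', y') \<in> U" "t' \<in> {0..1}" "y' \<in> V" by auto
    show "frechet_derivative g (at q) (0, v) = space_deriv v f q" for v
      unfolding q(1) space_deriv_def using fun_cong[OF frechet_derivative_at[OF D[OF q(2-4)]], of v] by simp
    show "frechet_derivative g (at q) (1, 0) = time_deriv f q"
      unfolding q(1) time_deriv_def using T[OF q(2-4)] q(3)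
      by (auto intro!: vector_derivative_within_closed_interval[symmetric])
  qed
qed

lemma smooth_on_space_deriv:
  assumes "smooth_on ({0..1} \<times> V) f" "open V"
  shows "smooth_on ({0..1} \<times> V) (space_deriv v f)"
  unfolding smooth_on_def
proof
  fix p assume "p \<in> {0..1::real} \<times> V"
  from smooth_on_cylinder_extension[OF assms this] obtain U g where "open U" "p \<in> U"
    "\<And>k w. Ck_on k (\<lambda>x. frechet_derivative g (at x) w) U"
    "\<And>q. q \<in> U \<inter> ({0..1} \<times> V) \<Longrightarrow> frechet_derivative g (at q) (0, v) = space_deriv v f q"
    by metis
  then show "\<exists>U g. open U \<and> p \<in> U \<and> (\<forall>k. Ck_on k g U) \<and> (\<forall>y\<in>U \<inter> ({0..1} \<times> V). g y = space_deriv v f y)"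
    by (intro exI[of _ U] exI[of _ "\<lambda>x. frechet_derivative g (at x) (0, v)"]) simp
qed

lemma smooth_on_time_deriv:
  assumes "smooth_on ({0..1} \<times> V) f" "open V"
  shows "smooth_on ({0..1} \<times> V) (time_deriv f)"
  unfolding smooth_on_def
proof
  fix p assume "p \<in> {0..1::real} \<times> V"
  from smooth_on_cylinder_extension[OF assms this] obtain U g where "open U" "p \<in> U"
    "\<And>k w. Ck_on k (\<lambda>x. frechet_derivative g (at x) w) U"
    "\<And>q. q \<in> U \<inter> ({0..1} \<times> V) \<Longrightarrow> frechet_derivative g (at q) (1, 0) = time_deriv f q"
    by metis
  then show "\<exists>U g. open U \<and> p \<in> U \<and> (\<forall>k. Ck_on k g U) \<and> (\<forall>y\<in>U \<inter> ({0..1} \<times> V). g y = time_deriv f y)"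
    by (intro exI[of _ U] exI[of _ "\<lambda>x. frechet_derivative g (at x) (1, 0)"]) simp
qed

lemma has_derivative_space_deriv:
  assumes "smooth_on ({0..1} \<times> V) f" "open V" "t \<in> {0..1}" "y \<in> V"
  shows "((\<lambda>z. f (t, z)) has_derivative (\<lambda>v. space_deriv v f (t, y))) (at y)"
proof -
  obtain U g where U: "(t, y) \<in> U" "((\<lambda>z. f (t, z)) has_derivative (\<lambda>v. frechet_derivative g (at (t, y)) (0, v))) (at y)"
    by (rule smooth_on_cylinder_local[OF assms]) (use assms in blast)
  then show ?thesis
    unfolding space_deriv_def by (simp add: frechet_derivative_at[symmetric])
qed

lemma has_vector_derivative_time_deriv:
  assumes "smooth_on ({0..1} \<times> V) f" "open V" "t \<in> {0..1}" "y \<in> V"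
  shows "((\<lambda>s. f (s, y)) has_vector_derivative time_deriv f (t, y)) (at t within {0..1})"
proof -
  obtain U g where U: "(t, y) \<in> U" "((\<lambda>s. f (s, y)) has_vector_derivative frechet_derivative g (at (t, y)) (1, 0)) (at t within {0..1})"
    by (rule smooth_on_cylinder_local[OF assms]) (use assms in blast)
  then show ?thesis
    unfolding time_deriv_def using assms(3)
    by (metis (no_types, lifting) case_prod_conv differentiableI_vector vector_derivative_works)
qed

lemma has_vector_derivative_along_line:
  assumes "(F has_derivative F') (at (q + r *\<^sub>R x))"
  shows "((\<lambda>r. F (q + r *\<^sub>R x)) has_vector_derivative F' x) (at r within S)"
proof -
  have "((\<lambda>r. q + r *\<^sub>R x) has_vector_derivative x) (at r within S)"
    unfolding has_vector_derivative_def by (auto intro!: derivative_eq_intros)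
  then show ?thesis
    using vector_derivative_diff_chain_within[of "\<lambda>r. q + r *\<^sub>R x" x r S F F'] assms
    by (simp add: o_def has_derivative_at_withinI)
qed

text \<open>Mixed derivatives agree because \<open>f\<close> is recovered from its time derivative by integration:
  differentiating \<open>f(t, y) - f(0, y) = \<integral> time_deriv f\<close> in space under the integral sign shows that
  \<open>space_deriv v f\<close> is an antiderivative of \<open>space_deriv v (time_deriv f)\<close>.\<close>

lemma time_deriv_space_deriv:
  fixes f :: "real \<times> 'a::euclidean_space \<Rightarrow> 'b::euclidean_space"
  assumes f: "smooth_on ({0..1} \<times> V) f" and V: "open V" and t: "t \<in> {0..1}" and y: "y \<in> V"
  shows "time_deriv (space_deriv v f) (t, y) = space_deriv v (time_deriv f) (t, y)"
proof -
  let ?T = "time_deriv f" and ?m = "space_deriv v (time_deriv f)"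
  have Ts: "smooth_on ({0..1} \<times> V) ?T" and Ss: "smooth_on ({0..1} \<times> V) (space_deriv v f)"
    using f V by (auto intro: smooth_on_time_deriv smooth_on_space_deriv)
  have ms: "smooth_on ({0..1} \<times> V) ?m"
    using Ts V by (rule smooth_on_space_deriv)
  have "open ((\<lambda>\<sigma>. y + \<sigma> *\<^sub>R v) -` V)"
    using V by (intro open_vimage continuous_intros) auto
  then obtain d where d: "d > 0" "cball 0 d \<subseteq> (\<lambda>\<sigma>. y + \<sigma> *\<^sub>R v) -` V"
    using y by (metis (mono_tags, lifting) add.right_neutral open_contains_cball scaleR_zero_left vimageI)
  define J where "J = cball (0::real) d"
  have JV: "y + \<sigma> *\<^sub>R v \<in> V" if "\<sigma> \<in> J" for \<sigma>
    using d that unfolding J_def by auto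
  have J0: "0 \<in> J" "convex J" using d unfolding J_def by auto
  have incr: "space_deriv v f (t, y) - space_deriv v f (0, y) = integral (cbox 0 t) (\<lambda>\<tau>. ?m (\<tau>, y))"
    if t: "t \<in> {0..1}" for t
  proof -
    have I: "((\<lambda>\<tau>. ?T (\<tau>, z)) has_integral (f (t, z) - f (0, z))) {0..t}" if "z \<in> V" for z
      by (rule fundamental_theorem_of_calculus)
         (use t that in \<open>auto intro!: has_vector_derivative_within_subset[OF has_vector_derivative_time_deriv[OF f V]]\<close>)
    have 1: "((\<lambda>\<sigma>. integral (cbox 0 t) (\<lambda>\<tau>. ?T (\<tau>, y + \<sigma> *\<^sub>R v)))
        has_vector_derivative integral (cbox 0 t) (\<lambda>\<tau>. ?m (\<tau>, y + 0 *\<^sub>R v))) (at 0 within J)"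
    proof (rule leibniz_rule_vector_derivative[OF _ _ _ J0])
      fix \<sigma> \<tau> assume s: "\<sigma> \<in> J" "\<tau> \<in> cbox 0 t"
      show "((\<lambda>\<sigma>. ?T (\<tau>, y + \<sigma> *\<^sub>R v)) has_vector_derivative ?m (\<tau>, y + \<sigma> *\<^sub>R v)) (at \<sigma> within J)"
        by (rule has_vector_derivative_along_line[OF has_derivative_space_deriv[OF Ts V]])
           (use t s JV in auto)
    next
      fix \<sigma> assume "\<sigma> \<in> J"
      then show "(\<lambda>\<tau>. ?T (\<tau>, y + \<sigma> *\<^sub>R v)) integrable_on cbox 0 t"
        using I[OF JV] by (auto simp: integrable_on_def)
    next
      show "continuous_on (J \<times> cbox 0 t) (\<lambda>(\<sigma>, \<tau>). ?m (\<tau>, y + \<sigma> *\<^sub>R v))"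
        unfolding split_beta
        by (rule continuous_on_compose2[OF smooth_on_imp_continuous_on[OF ms]])
           (use t JV in \<open>auto intro!: continuous_intros\<close>)
    qed
    have 2: "((\<lambda>\<sigma>. f (t, y + \<sigma> *\<^sub>R v) - f (0, y + \<sigma> *\<^sub>R v)) has_vector_derivative
        space_deriv v f (t, y + 0 *\<^sub>R v) - space_deriv v f (0, y + 0 *\<^sub>R v)) (at 0 within J)"
      by (intro has_vector_derivative_diff has_vector_derivative_along_line has_derivative_space_deriv[OF f V])
         (use t y in auto)
    have "((\<lambda>\<sigma>. f (t, y + \<sigma> *\<^sub>R v) - f (0, y + \<sigma> *\<^sub>R v)) has_vector_derivative
          integral (cbox 0 t) (\<lambda>\<tau>. ?m (\<tau>, y + 0 *\<^sub>R v))) (at 0 within J)"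
      using 1 by (rule has_vector_derivative_transform[OF J0(1), rotated])
         (simp add: integral_unique[OF I[OF JV]])
    moreover have J: "J = cbox (-d) d" unfolding J_def by (auto simp: dist_real_def)
    ultimately show ?thesis
      using vector_derivative_unique_within_closed_interval[of "-d" d 0, OF _ _ 2[unfolded J]] d(1)
      by simp
  qed
  have mc: "continuous_on {0..1} (\<lambda>\<tau>. ?m (\<tau>, y))"
    by (rule continuous_on_compose2[OF smooth_on_imp_continuous_on[OF ms]])
       (use y in \<open>auto intro!: continuous_intros\<close>)
  have "((\<lambda>t. integral {0..t} (\<lambda>\<tau>. ?m (\<tau>, y))) has_vector_derivative ?m (t, y)) (at t within {0..1})"
    using integral_has_vector_derivative[OF mc t] .
  then have "((\<lambda>t. space_deriv v f (0, y) + integral {0..t} (\<lambda>\<tau>. ?m (\<tau>, y))) has_vector_derivative ?m (t, y)) (at t within {0..1})"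
    by (auto intro!: derivative_eq_intros)
  then have "((\<lambda>t. space_deriv v f (t, y)) has_vector_derivative ?m (t, y)) (at t within {0..1})"
  proof (rule has_vector_derivative_transform[OF t, rotated])
    show "space_deriv v f (s, y) = space_deriv v f (0, y) + integral {0..s} (\<lambda>\<tau>. ?m (\<tau>, y))"
      if "s \<in> {0..1}" for s
      using incr[OF that] unfolding box_real by (metis add.commute diff_add_cancel)
  qed
  then show ?thesis
    using vector_derivative_unique_within_closed_interval[of 0 1 t,
        OF _ _ has_vector_derivative_time_deriv[OF Ss V t y, folded box_real(2)]] t by simp
qed

section \<open>Closed two-forms and the area of the cone over a loop\<close>

text \<open>A closed two-form \<open>\<Omega>\<close> of class \<open>C\<^sup>1\<close> on an open set; \<open>D\<Omega> y w u v\<close> is the derivative of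
  \<open>\<Omega> y u v\<close> in \<open>y\<close> in the direction \<open>w\<close>. The expansions in the standard basis reduce the
  product rule and joint continuity to the finitely many coefficient functions.\<close>

locale closed_form_on_open =
  fixes V :: "'e::euclidean_space set" and \<Omega> :: "'e \<Rightarrow> 'e \<Rightarrow> 'e \<Rightarrow> real"
    and D\<Omega> :: "'e \<Rightarrow> 'e \<Rightarrow> 'e \<Rightarrow> 'e \<Rightarrow> real"
  assumes open_dom: "open V"
    and form_bilinear: "y \<in> V \<Longrightarrow> bilinear (\<Omega> y)"
    and form_self: "y \<in> V \<Longrightarrow> \<Omega> y u u = 0"
    and form_deriv: "y \<in> V \<Longrightarrow> ((\<lambda>z. \<Omega> z u v) has_derivative (\<lambda>w. D\<Omega> y w u v)) (at y)"
    and form_deriv_continuous: "continuous_on V (\<lambda>y. D\<Omega> y w u v)"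
    and form_closed: "y \<in> V \<Longrightarrow> D\<Omega> y u v w - D\<Omega> y v u w + D\<Omega> y w u v = 0"
begin

lemma form_swap: "y \<in> V \<Longrightarrow> \<Omega> y v u = - \<Omega> y u v"
  using form_self[of y "u + v"] form_self[of y u] form_self[of y v] form_bilinear[of y]
  by (simp add: bilinear_ladd bilinear_radd)

lemma form_deriv_swap:
  assumes "y \<in> V" shows "D\<Omega> y w v u = - D\<Omega> y w u v"
proof -
  have "((\<lambda>z. - \<Omega> z u v) has_derivative (\<lambda>w. D\<Omega> y w v u)) (at y)"
    by (rule has_derivative_transform_within_open[OF form_deriv[OF assms] open_dom assms])
       (rule form_swap)
  moreover have "((\<lambda>z. - \<Omega> z u v) has_derivative (\<lambda>w. - D\<Omega> y w u v)) (at y)"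
    using form_deriv[OF assms] by (rule has_derivative_minus)
  ultimately show ?thesis
    by (auto dest: has_derivative_unique fun_cong)
qed

lemma form_zero [simp]: "y \<in> V \<Longrightarrow> \<Omega> y 0 v = 0" "y \<in> V \<Longrightarrow> \<Omega> y v 0 = 0"
  using form_bilinear by (auto simp: bilinear_lzero bilinear_rzero)

lemma form_expand:
  assumes "y \<in> V"
  shows "\<Omega> y a b = (\<Sum>i\<in>Basis. \<Sum>j\<in>Basis. (a \<bullet> i) * (b \<bullet> j) * \<Omega> y i j)"
proof -
  have "\<Omega> y a b = \<Omega> y (\<Sum>i\<in>Basis. (a \<bullet> i) *\<^sub>R i) (\<Sum>j\<in>Basis. (b \<bullet> j) *\<^sub>R j)"
    by (simp add: euclidean_representation)
  also have "\<dots> = (\<Sum>(i,j)\<in>Basis \<times> Basis. \<Omega> y ((a \<bullet> i) *\<^sub>R i) ((b \<bullet> j) *\<^sub>R j))"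
    by (rule bilinear_sum[OF form_bilinear[OF assms]])
  also have "\<dots> = (\<Sum>i\<in>Basis. \<Sum>j\<in>Basis. (a \<bullet> i) * (b \<bullet> j) * \<Omega> y i j)"
    by (simp add: sum.cartesian_product bilinear_lmul[OF form_bilinear[OF assms]]
        bilinear_rmul[OF form_bilinear[OF assms]] mult_ac)
  finally show ?thesis .
qed

lemma form_deriv_expand:
  assumes "y \<in> V"
  shows "D\<Omega> y w a b = (\<Sum>i\<in>Basis. \<Sum>j\<in>Basis. (a \<bullet> i) * (b \<bullet> j) * D\<Omega> y w i j)"
proof -
  have "((\<lambda>z. \<Sum>i\<in>Basis. \<Sum>j\<in>Basis. (a \<bullet> i) * (b \<bullet> j) * \<Omega> z i j) has_derivative
      (\<lambda>w. \<Sum>i\<in>Basis. \<Sum>j\<in>Basis. (a \<bullet> i) * (b \<bullet> j) * D\<Omega> y w i j)) (at y)"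
    by (intro has_derivative_sum has_derivative_mult_right form_deriv assms)
  then have "((\<lambda>z. \<Omega> z a b) has_derivative
      (\<lambda>w. \<Sum>i\<in>Basis. \<Sum>j\<in>Basis. (a \<bullet> i) * (b \<bullet> j) * D\<Omega> y w i j)) (at y)"
    by (rule has_derivative_transform_within_open[OF _ open_dom assms]) (rule form_expand[symmetric])
  from fun_cong[OF has_derivative_unique[OF form_deriv[OF assms] this]] show ?thesis .
qed

lemma form_deriv_linear: "y \<in> V \<Longrightarrow> linear (\<lambda>w. D\<Omega> y w a b)"
  using form_deriv has_derivative_linear by blast

lemma has_vector_derivative_form:
  assumes c: "(c has_vector_derivative c') (at r within S)"
    and a: "(a has_vector_derivative a') (at r within S)"
    and b: "(b has_vector_derivative b') (at r within S)"
    and r: "r \<in> S" and sub: "c ` S \<subseteq> V"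
  shows "((\<lambda>r. \<Omega> (c r) (a r) (b r)) has_vector_derivative
     D\<Omega> (c r) c' (a r) (b r) + \<Omega> (c r) a' (b r) + \<Omega> (c r) (a r) b') (at r within S)"
proof -
  have cV: "c r \<in> V" using r sub by auto
  let ?E = "\<lambda>r. \<Sum>i\<in>Basis. \<Sum>j\<in>Basis. (a r \<bullet> i) * (b r \<bullet> j) * \<Omega> (c r) i j"
  have 1: "((\<lambda>r. \<Omega> (c r) i j) has_field_derivative D\<Omega> (c r) c' i j) (at r within S)" for i j
    using vector_derivative_diff_chain_within[OF c has_derivative_at_withinI[OF form_deriv[OF cV, of i j]]]
    by (simp add: o_def has_real_derivative_iff_has_vector_derivative)
  have 2: "((\<lambda>r. a r \<bullet> i) has_field_derivative a' \<bullet> i) (at r within S)" for i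
    using bounded_linear.has_vector_derivative[OF bounded_linear_inner_left a]
    by (simp add: has_real_derivative_iff_has_vector_derivative)
  have 3: "((\<lambda>r. b r \<bullet> i) has_field_derivative b' \<bullet> i) (at r within S)" for i
    using bounded_linear.has_vector_derivative[OF bounded_linear_inner_left b]
    by (simp add: has_real_derivative_iff_has_vector_derivative)
  have "(?E has_field_derivative (\<Sum>i\<in>Basis. \<Sum>j\<in>Basis.
      (((a' \<bullet> i) * (b r \<bullet> j) + (b' \<bullet> j) * (a r \<bullet> i)) * \<Omega> (c r) i j
        + D\<Omega> (c r) c' i j * ((a r \<bullet> i) * (b r \<bullet> j))))) (at r within S)"
    by (intro DERIV_sum DERIV_mult 1 2 3)
  also have "(\<Sum>i\<in>Basis. \<Sum>j\<in>Basis.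
      (((a' \<bullet> i) * (b r \<bullet> j) + (b' \<bullet> j) * (a r \<bullet> i)) * \<Omega> (c r) i j
        + D\<Omega> (c r) c' i j * ((a r \<bullet> i) * (b r \<bullet> j))))
     = D\<Omega> (c r) c' (a r) (b r) + \<Omega> (c r) a' (b r) + \<Omega> (c r) (a r) b'"
    unfolding form_deriv_expand[OF cV, of c' "a r" "b r"] form_expand[OF cV, of a' "b r"]
      form_expand[OF cV, of "a r" b']
    by (simp add: sum.distrib algebra_simps)
  finally have "(?E has_vector_derivative
      D\<Omega> (c r) c' (a r) (b r) + \<Omega> (c r) a' (b r) + \<Omega> (c r) (a r) b') (at r within S)"
    by (simp add: has_real_derivative_iff_has_vector_derivative)
  then show ?thesis
    by (rule has_vector_derivative_transform[OF r, rotated])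
       (use sub in \<open>auto intro!: form_expand\<close>)
qed

lemma continuous_on_form:
  assumes "continuous_on S c" "continuous_on S a" "continuous_on S b" "c ` S \<subseteq> V"
  shows "continuous_on S (\<lambda>x. \<Omega> (c x) (a x) (b x))"
proof -
  have "continuous_on V (\<lambda>y. \<Omega> y i j)" for i j
    by (intro continuous_at_imp_continuous_on ballI has_derivative_continuous[OF form_deriv])
  then have "continuous_on S (\<lambda>x. \<Omega> (c x) i j)" for i j
    using continuous_on_compose2 assms by blast
  then have "continuous_on S (\<lambda>x. \<Sum>i\<in>Basis. \<Sum>j\<in>Basis. (a x \<bullet> i) * (b x \<bullet> j) * \<Omega> (c x) i j)"
    by (intro continuous_intros assms)
  moreover have "\<Omega> (c x) (a x) (b x) = (\<Sum>i\<in>Basis. \<Sum>j\<in>Basis. (a x \<bullet> i) * (b x \<bullet> j) * \<Omega> (c x) i j)"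
    if "x \<in> S" for x
    by (rule form_expand) (use that assms in auto)
  ultimately show ?thesis
    by (rule continuous_on_eq[OF _ sym])
qed

lemma continuous_on_form_deriv:
  assumes "continuous_on S c" "continuous_on S w" "continuous_on S a" "continuous_on S b" "c ` S \<subseteq> V"
  shows "continuous_on S (\<lambda>x. D\<Omega> (c x) (w x) (a x) (b x))"
proof -
  have "continuous_on S (\<lambda>x. D\<Omega> (c x) k i j)" for i j k
    using continuous_on_compose2[OF form_deriv_continuous assms(1,5)] by blast
  then have "continuous_on S (\<lambda>x. \<Sum>i\<in>Basis. \<Sum>j\<in>Basis. (a x \<bullet> i) * (b x \<bullet> j) *
       (\<Sum>k\<in>Basis. (w x \<bullet> k) * D\<Omega> (c x) k i j))"
    by (intro continuous_intros assms)
  moreover have "D\<Omega> (c x) (w x) (a x) (b x) = (\<Sum>i\<in>Basis. \<Sum>j\<in>Basis. (a x \<bullet> i) * (b x \<bullet> j) *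
       (\<Sum>k\<in>Basis. (w x \<bullet> k) * D\<Omega> (c x) k i j))" if "x \<in> S" for x
  proof -
    have V: "c x \<in> V" using that assms by auto
    have "D\<Omega> (c x) (w x) i j = (\<Sum>k\<in>Basis. (w x \<bullet> k) * D\<Omega> (c x) k i j)" for i j
      using linear_sum[OF form_deriv_linear[OF V], of "\<lambda>k. (w x \<bullet> k) *\<^sub>R k" Basis i j]
      by (simp add: euclidean_representation linear_scale[OF form_deriv_linear[OF V]])
    then show ?thesis
      by (subst form_deriv_expand[OF V]) simp
  qed
  ultimately show ?thesis
    by (rule continuous_on_eq[OF _ sym])
qed

end

text \<open>A family of loops \<open>g r\<close> with base points \<open>q + r x\<close> on a segment, contracting to the constant
  loop at \<open>q\<close> for \<open>r = 0\<close>. Everything takes place in a convex set \<open>W\<close>, so that the cone from the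
  base point over each loop stays in the domain of the form. The mixed derivative \<open>g\<^sub>r\<^sub>t\<close> is shared
  by both orders of differentiation.\<close>

locale loop_family = closed_form_on_open V \<Omega> D\<Omega>
  for V :: "'e::euclidean_space set" and \<Omega> D\<Omega> +
  fixes W :: "'e set" and q x :: 'e and g g\<^sub>r g\<^sub>t g\<^sub>r\<^sub>t :: "real \<Rightarrow> real \<Rightarrow> 'e"
  assumes W: "convex W" "W \<subseteq> V"
    and base_in: "r \<in> {0..1} \<Longrightarrow> q + r *\<^sub>R x \<in> W"
    and loop_in: "r \<in> {0..1} \<Longrightarrow> t \<in> {0..1} \<Longrightarrow> g r t \<in> W"
    and loop_start: "r \<in> {0..1} \<Longrightarrow> g r 0 = q + r *\<^sub>R x"
    and loop_end: "r \<in> {0..1} \<Longrightarrow> g r 1 = q + r *\<^sub>R x"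
    and loop_constant: "t \<in> {0..1} \<Longrightarrow> g 0 t = q"
    and g_r: "r \<in> {0..1} \<Longrightarrow> t \<in> {0..1} \<Longrightarrow>
       ((\<lambda>r. g r t) has_vector_derivative g\<^sub>r r t) (at r within {0..1})"
    and g_t: "r \<in> {0..1} \<Longrightarrow> t \<in> {0..1} \<Longrightarrow>
       ((\<lambda>t. g r t) has_vector_derivative g\<^sub>t r t) (at t within {0..1})"
    and g_rt: "r \<in> {0..1} \<Longrightarrow> t \<in> {0..1} \<Longrightarrow>
       ((\<lambda>t. g\<^sub>r r t) has_vector_derivative g\<^sub>r\<^sub>t r t) (at t within {0..1})"
    and g_tr: "r \<in> {0..1} \<Longrightarrow> t \<in> {0..1} \<Longrightarrow>
       ((\<lambda>r. g\<^sub>t r t) has_vector_derivative g\<^sub>r\<^sub>t r t) (at r within {0..1})"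
    and continuous_g: "continuous_on ({0..1} \<times> {0..1}) (\<lambda>(r, t). g r t)"
    and continuous_g_r: "continuous_on ({0..1} \<times> {0..1}) (\<lambda>(r, t). g\<^sub>r r t)"
    and continuous_g_t: "continuous_on ({0..1} \<times> {0..1}) (\<lambda>(r, t). g\<^sub>t r t)"
    and continuous_g_rt: "continuous_on ({0..1} \<times> {0..1}) (\<lambda>(r, t). g\<^sub>r\<^sub>t r t)"
begin

text \<open>The cone \<open>(s, t) \<mapsto> cone r s t\<close> over the loop \<open>g r\<close> has its apex at the base point of that loop.
  This choice makes \<open>cone_area\<close> quadratic in the length of the loop. The derivative of \<open>cone\<close> in
  \<open>s\<close> is \<open>cone\<^sub>s\<close>, and the one in \<open>t\<close> is \<open>s *\<^sub>R g\<^sub>t r t\<close>.\<close>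

definition cone :: "real \<Rightarrow> real \<Rightarrow> real \<Rightarrow> 'e" where
  "cone r s t = q + r *\<^sub>R x + s *\<^sub>R (g r t - (q + r *\<^sub>R x))"

definition cone\<^sub>r :: "real \<Rightarrow> real \<Rightarrow> real \<Rightarrow> 'e" where
  "cone\<^sub>r r s t = x + s *\<^sub>R (g\<^sub>r r t - x)"

definition cone\<^sub>s :: "real \<Rightarrow> real \<Rightarrow> 'e" where
  "cone\<^sub>s r t = g r t - (q + r *\<^sub>R x)"

definition cone_area :: "real \<Rightarrow> real" where
  "cone_area r = integral {0..1} (\<lambda>t. integral {0..1} (\<lambda>s. \<Omega> (cone r s t) (cone\<^sub>s r t) (s *\<^sub>R g\<^sub>t r t)))"

lemma cone_in:
  assumes "r \<in> {0..1}" "s \<in> {0..1}" "t \<in> {0..1}" shows "cone r s t \<in> V"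
proof -
  have "cone r s t = (1 - s) *\<^sub>R (q + r *\<^sub>R x) + s *\<^sub>R g r t"
    by (simp add: cone_def algebra_simps)
  also have "\<dots> \<in> W"
    using assms base_in loop_in by (intro convexD[OF W(1)]) auto
  finally show ?thesis using W(2) by blast
qed

lemma cone_has_vector_derivative:
  assumes "r \<in> {0..1}" "t \<in> {0..1}"
  shows "((\<lambda>r. cone r s t) has_vector_derivative cone\<^sub>r r s t) (at r within {0..1})"
    and "((\<lambda>s. cone r s t) has_vector_derivative cone\<^sub>s r t) (at s within {0..1})"
    and "((\<lambda>t. cone r s t) has_vector_derivative s *\<^sub>R g\<^sub>t r t) (at t within {0..1})"
    and "((\<lambda>r. cone\<^sub>s r t) has_vector_derivative g\<^sub>r r t - x) (at r within {0..1})"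
    and "((\<lambda>t. cone\<^sub>s r t) has_vector_derivative g\<^sub>t r t) (at t within {0..1})"
    and "((\<lambda>s. cone\<^sub>r r s t) has_vector_derivative g\<^sub>r r t - x) (at s within {0..1})"
    and "((\<lambda>t. cone\<^sub>r r s t) has_vector_derivative s *\<^sub>R g\<^sub>r\<^sub>t r t) (at t within {0..1})"
    and "((\<lambda>s. s *\<^sub>R g\<^sub>t r t) has_vector_derivative g\<^sub>t r t) (at s within {0..1})"
    and "((\<lambda>r. s *\<^sub>R g\<^sub>t r t) has_vector_derivative s *\<^sub>R g\<^sub>r\<^sub>t r t) (at r within {0..1})"
  unfolding cone_def cone\<^sub>r_def cone\<^sub>s_def
  by (auto intro!: derivative_eq_intros g_r[OF assms] g_t[OF assms] g_rt[OF assms] g_tr[OF assms])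


lemma continuous_on_cone:
  fixes \<rho> \<sigma> \<tau> :: "'z::topological_space \<Rightarrow> real"
  assumes \<rho>: "continuous_on S \<rho>" "\<rho> ` S \<subseteq> {0..1}" and \<sigma>: "continuous_on S \<sigma>" "\<sigma> ` S \<subseteq> {0..1}"
    and \<tau>: "continuous_on S \<tau>" "\<tau> ` S \<subseteq> {0..1}"
  shows "continuous_on S (\<lambda>z. cone (\<rho> z) (\<sigma> z) (\<tau> z))"
    and "continuous_on S (\<lambda>z. cone\<^sub>r (\<rho> z) (\<sigma> z) (\<tau> z))"
    and "continuous_on S (\<lambda>z. cone\<^sub>s (\<rho> z) (\<tau> z))"
    and "continuous_on S (\<lambda>z. g (\<rho> z) (\<tau> z))"
    and "continuous_on S (\<lambda>z. g\<^sub>r (\<rho> z) (\<tau> z))"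
    and "continuous_on S (\<lambda>z. g\<^sub>t (\<rho> z) (\<tau> z))"
    and "continuous_on S (\<lambda>z. g\<^sub>r\<^sub>t (\<rho> z) (\<tau> z))"
    and "(\<lambda>z. cone (\<rho> z) (\<sigma> z) (\<tau> z)) ` S \<subseteq> V"
    and "(\<lambda>z. g (\<rho> z) (\<tau> z)) ` S \<subseteq> V"
proof -
  have sub: "(\<lambda>z. (\<rho> z, \<tau> z)) ` S \<subseteq> {0..1} \<times> {0..1}"
    using \<rho> \<tau> by auto
  have pair: "continuous_on S (\<lambda>z. (\<rho> z, \<tau> z))"
    using \<rho> \<tau> by (intro continuous_intros)
  show g: "continuous_on S (\<lambda>z. g (\<rho> z) (\<tau> z))"
    using continuous_on_compose2[OF continuous_g pair sub] by simp
  show gr: "continuous_on S (\<lambda>z. g\<^sub>r (\<rho> z) (\<tau> z))"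
    using continuous_on_compose2[OF continuous_g_r pair sub] by simp
  show "continuous_on S (\<lambda>z. g\<^sub>t (\<rho> z) (\<tau> z))"
    using continuous_on_compose2[OF continuous_g_t pair sub] by simp
  show "continuous_on S (\<lambda>z. g\<^sub>r\<^sub>t (\<rho> z) (\<tau> z))"
    using continuous_on_compose2[OF continuous_g_rt pair sub] by simp
  show "continuous_on S (\<lambda>z. cone (\<rho> z) (\<sigma> z) (\<tau> z))"
    "continuous_on S (\<lambda>z. cone\<^sub>r (\<rho> z) (\<sigma> z) (\<tau> z))"
    "continuous_on S (\<lambda>z. cone\<^sub>s (\<rho> z) (\<tau> z))"
    unfolding cone_def cone\<^sub>r_def cone\<^sub>s_def by (intro continuous_intros g gr \<rho> \<sigma> \<tau>)+
  show "(\<lambda>z. cone (\<rho> z) (\<sigma> z) (\<tau> z)) ` S \<subseteq> V"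
    using \<rho> \<sigma> \<tau> cone_in by (auto simp: image_subset_iff)
  show "(\<lambda>z. g (\<rho> z) (\<tau> z)) ` S \<subseteq> V"
    using \<rho> \<tau> loop_in W(2) by (auto simp: image_subset_iff subset_iff)
qed

text \<open>With \<open>w = cone r s t\<close>, the functions \<open>area_r\<close> and \<open>area_t\<close> are \<open>\<partial>\<^sub>r (\<Omega> w w\<^sub>s w\<^sub>t)\<close> and
  \<open>\<partial>\<^sub>t (\<Omega> w w\<^sub>s w\<^sub>r)\<close>, expanded by the product rule.\<close>

definition area_r :: "real \<Rightarrow> real \<Rightarrow> real \<Rightarrow> real" where
  "area_r r t s = D\<Omega> (cone r s t) (cone\<^sub>r r s t) (cone\<^sub>s r t) (s *\<^sub>R g\<^sub>t r t)
     + \<Omega> (cone r s t) (g\<^sub>r r t - x) (s *\<^sub>R g\<^sub>t r t)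
     + \<Omega> (cone r s t) (cone\<^sub>s r t) (s *\<^sub>R g\<^sub>r\<^sub>t r t)"

definition area_t :: "real \<Rightarrow> real \<Rightarrow> real \<Rightarrow> real" where
  "area_t r t s = D\<Omega> (cone r s t) (s *\<^sub>R g\<^sub>t r t) (cone\<^sub>s r t) (cone\<^sub>r r s t)
     + \<Omega> (cone r s t) (g\<^sub>t r t) (cone\<^sub>r r s t)
     + \<Omega> (cone r s t) (cone\<^sub>s r t) (s *\<^sub>R g\<^sub>r\<^sub>t r t)"

lemma continuous_on_area:
  fixes \<rho> \<sigma> \<tau> :: "'z::topological_space \<Rightarrow> real"
  assumes "continuous_on S \<rho>" "\<rho> ` S \<subseteq> {0..1}" "continuous_on S \<sigma>" "\<sigma> ` S \<subseteq> {0..1}"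
    "continuous_on S \<tau>" "\<tau> ` S \<subseteq> {0..1}"
  shows "continuous_on S (\<lambda>z. area_r (\<rho> z) (\<tau> z) (\<sigma> z))"
    and "continuous_on S (\<lambda>z. area_t (\<rho> z) (\<tau> z) (\<sigma> z))"
    and "continuous_on S (\<lambda>z. \<Omega> (cone (\<rho> z) (\<sigma> z) (\<tau> z)) (cone\<^sub>s (\<rho> z) (\<tau> z)) (\<sigma> z *\<^sub>R g\<^sub>t (\<rho> z) (\<tau> z)))"
    and "continuous_on S (\<lambda>z. \<Omega> (cone (\<rho> z) (\<sigma> z) (\<tau> z)) (cone\<^sub>s (\<rho> z) (\<tau> z)) (cone\<^sub>r (\<rho> z) (\<sigma> z) (\<tau> z)))"
    and "continuous_on S (\<lambda>z. \<Omega> (g (\<rho> z) (\<tau> z)) (g\<^sub>r (\<rho> z) (\<tau> z)) (g\<^sub>t (\<rho> z) (\<tau> z)))"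
  unfolding area_r_def area_t_def
  by (intro continuous_intros continuous_on_form continuous_on_form_deriv continuous_on_cone[OF assms] assms)+

text \<open>The pullback of a closed form under the map \<open>(r, s, t) \<mapsto> cone r s t\<close> is closed:
  \<open>\<partial>\<^sub>r (\<Omega> w w\<^sub>s w\<^sub>t) - \<partial>\<^sub>t (\<Omega> w w\<^sub>s w\<^sub>r) = \<partial>\<^sub>s (\<Omega> w w\<^sub>r w\<^sub>t)\<close>. The terms with second derivatives of
  \<open>w\<close> cancel by antisymmetry, and what remains is the closedness of \<open>\<Omega>\<close>.\<close>

lemma area_closed:
  assumes "r \<in> {0..1}" "t \<in> {0..1}" "s \<in> {0..1}"
  shows "((\<lambda>s. \<Omega> (cone r s t) (cone\<^sub>r r s t) (s *\<^sub>R g\<^sub>t r t)) has_vector_derivative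
     area_r r t s - area_t r t s) (at s within {0..1})"
proof -
  have V: "cone r s t \<in> V" using assms cone_in by blast
  have "((\<lambda>s. \<Omega> (cone r s t) (cone\<^sub>r r s t) (s *\<^sub>R g\<^sub>t r t)) has_vector_derivative
      D\<Omega> (cone r s t) (cone\<^sub>s r t) (cone\<^sub>r r s t) (s *\<^sub>R g\<^sub>t r t)
      + \<Omega> (cone r s t) (g\<^sub>r r t - x) (s *\<^sub>R g\<^sub>t r t)
      + \<Omega> (cone r s t) (cone\<^sub>r r s t) (g\<^sub>t r t)) (at s within {0..1})"
    by (rule has_vector_derivative_form)
       (use cone_has_vector_derivative[OF assms(1,2)] assms cone_in in auto)
  also have "D\<Omega> (cone r s t) (cone\<^sub>s r t) (cone\<^sub>r r s t) (s *\<^sub>R g\<^sub>t r t)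
      + \<Omega> (cone r s t) (g\<^sub>r r t - x) (s *\<^sub>R g\<^sub>t r t)
      + \<Omega> (cone r s t) (cone\<^sub>r r s t) (g\<^sub>t r t) = area_r r t s - area_t r t s"
    using form_closed[OF V, of "cone\<^sub>r r s t" "cone\<^sub>s r t" "s *\<^sub>R g\<^sub>t r t"]
      form_deriv_swap[OF V, of "s *\<^sub>R g\<^sub>t r t" "cone\<^sub>s r t" "cone\<^sub>r r s t"]
      form_swap[OF V, of "g\<^sub>t r t" "cone\<^sub>r r s t"]
    unfolding area_r_def area_t_def by simp
  finally show ?thesis .
qed

text \<open>Stokes for the solid swept out by the cones. Integrating \<open>area_closed\<close> over \<open>s\<close> and \<open>t\<close>
  leaves only boundary terms. The face \<open>s = 1\<close> gives the integrand on the right; the face \<open>s = 0\<close>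
  vanishes because the apex does not move with \<open>t\<close>, and the faces \<open>t = 0\<close> and \<open>t = 1\<close> vanish because
  there the cone degenerates to its apex.\<close>

lemma cone_area_deriv:
  assumes r: "r \<in> {0..1}"
  shows "(cone_area has_vector_derivative integral {0..1} (\<lambda>t. \<Omega> (g r t) (g\<^sub>r r t) (g\<^sub>t r t)))
     (at r within {0..1})"
proof -
  let ?I = "cbox (0::real) 1"
  \<comment> \<open>The integrals over \<open>s\<close> alone: \<open>\<alpha>\<close> is the area density in \<open>t\<close>, and \<open>\<beta>\<close> is the primitive
      whose boundary values at \<open>t = 0\<close> and \<open>t = 1\<close> vanish.\<close>
  define \<alpha> where "\<alpha> = (\<lambda>r t. integral ?I (\<lambda>s. \<Omega> (cone r s t) (cone\<^sub>s r t) (s *\<^sub>R g\<^sub>t r t)))"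
  define \<beta> where "\<beta> = (\<lambda>t. integral ?I (\<lambda>s. \<Omega> (cone r s t) (cone\<^sub>s r t) (cone\<^sub>r r s t)))"
  have \<alpha>: "((\<lambda>r. \<alpha> r t) has_vector_derivative integral ?I (area_r r t)) (at r within ?I)"
    if "t \<in> ?I" "r \<in> ?I" for r t
    unfolding \<alpha>_def
  proof (rule leibniz_rule_vector_derivative)
    show "((\<lambda>r. \<Omega> (cone r s t) (cone\<^sub>s r t) (s *\<^sub>R g\<^sub>t r t)) has_vector_derivative area_r r t s)
        (at r within ?I)" if "r \<in> ?I" "s \<in> ?I" for r s
      unfolding area_r_def
      by (rule has_vector_derivative_form)
         (use cone_has_vector_derivative[of r t] that \<open>t \<in> ?I\<close> cone_in in auto)
    show "(\<lambda>s. \<Omega> (cone r s t) (cone\<^sub>s r t) (s *\<^sub>R g\<^sub>t r t)) integrable_on ?I" if "r \<in> ?I" for r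
      by (intro integrable_continuous continuous_on_area continuous_intros)
         (use that \<open>t \<in> ?I\<close> in auto)
    show "continuous_on (?I \<times> ?I) (\<lambda>(r, s). area_r r t s)"
      unfolding split_beta by (intro continuous_on_area continuous_intros) (use \<open>t \<in> ?I\<close> in auto)
  qed (use that in auto)
  have \<beta>: "(\<beta> has_vector_derivative integral ?I (area_t r t)) (at t within ?I)" if "t \<in> ?I" for t
    unfolding \<beta>_def
  proof (rule leibniz_rule_vector_derivative)
    show "((\<lambda>t. \<Omega> (cone r s t) (cone\<^sub>s r t) (cone\<^sub>r r s t)) has_vector_derivative area_t r t s)
        (at t within ?I)" if "t \<in> ?I" "s \<in> ?I" for t s
      unfolding area_t_def
      by (rule has_vector_derivative_form)
         (use cone_has_vector_derivative[of r t] that r cone_in in auto)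
    show "(\<lambda>s. \<Omega> (cone r s t) (cone\<^sub>s r t) (cone\<^sub>r r s t)) integrable_on ?I" if "t \<in> ?I" for t
      by (intro integrable_continuous continuous_on_area continuous_intros)
         (use that r in auto)
    show "continuous_on (?I \<times> ?I) (\<lambda>(t, s). area_t r t s)"
      unfolding split_beta by (intro continuous_on_area continuous_intros) (use r in auto)
  qed (use that in auto)
  have \<beta>0: "\<beta> 0 = 0" "\<beta> 1 = 0"
  proof -
    have "cone\<^sub>s r 0 = 0" "cone\<^sub>s r 1 = 0"
      using r loop_start loop_end by (auto simp: cone\<^sub>s_def)
    then have "integral ?I (\<lambda>s. \<Omega> (cone r s t) (cone\<^sub>s r t) (cone\<^sub>r r s t)) = integral ?I (\<lambda>s. 0)"
      if "t = 0 \<or> t = 1" for t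
      by (intro integral_cong) (use that r cone_in in auto)
    then show "\<beta> 0 = 0" "\<beta> 1 = 0" unfolding \<beta>_def by auto
  qed
  have \<beta>int: "(\<lambda>t. integral ?I (area_t r t)) integrable_on ?I"
    "integral ?I (\<lambda>t. integral ?I (area_t r t)) = 0"
    using fundamental_theorem_of_calculus[of 0 1 \<beta> "\<lambda>t. integral ?I (area_t r t)"] \<beta> \<beta>0
    by (auto dest: integral_unique simp: integrable_on_def)
  have diff: "integral ?I (area_r r t) - integral ?I (area_t r t) = \<Omega> (g r t) (g\<^sub>r r t) (g\<^sub>t r t)"
    if t: "t \<in> ?I" for t
  proof -
    have gV: "g r t \<in> V" "q + r *\<^sub>R x \<in> V" using loop_in base_in W(2) r t by auto
    have "((\<lambda>s. area_r r t s - area_t r t s) has_integral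
        (\<Omega> (cone r 1 t) (cone\<^sub>r r 1 t) (1 *\<^sub>R g\<^sub>t r t) - \<Omega> (cone r 0 t) (cone\<^sub>r r 0 t) (0 *\<^sub>R g\<^sub>t r t))) {0..1}"
      by (rule fundamental_theorem_of_calculus) (use area_closed r t in auto)
    then have "integral ?I (\<lambda>s. area_r r t s - area_t r t s) = \<Omega> (g r t) (g\<^sub>r r t) (g\<^sub>t r t)"
      using gV by (simp add: integral_unique cone_def cone\<^sub>r_def)
    moreover have "area_r r t integrable_on ?I" "area_t r t integrable_on ?I"
      by (intro integrable_continuous continuous_on_area continuous_intros; use r t in auto)+
    ultimately show ?thesis
      by (simp add: integral_diff)
  qed
  have "(cone_area has_vector_derivative integral ?I (\<lambda>t. integral ?I (area_r r t))) (at r within ?I)"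
  proof -
    have "cone_area = (\<lambda>r. integral ?I (\<alpha> r))"
      unfolding cone_area_def \<alpha>_def by auto
    moreover have "((\<lambda>r. integral ?I (\<alpha> r)) has_vector_derivative integral ?I (\<lambda>t. integral ?I (area_r r t))) (at r within ?I)"
    proof (rule leibniz_rule_vector_derivative)
      show "((\<lambda>r. \<alpha> r t) has_vector_derivative integral ?I (area_r r t)) (at r within ?I)"
        if "r \<in> ?I" "t \<in> ?I" for r t using \<alpha> that by blast
      show "\<alpha> r integrable_on ?I" if "r \<in> ?I" for r
        unfolding \<alpha>_def
      proof (intro integrable_continuous integral_continuous_on_param)
        show "continuous_on (?I \<times> ?I) (\<lambda>(t, s). \<Omega> (cone r s t) (cone\<^sub>s r t) (s *\<^sub>R g\<^sub>t r t))"
          unfolding split_beta by (intro continuous_on_area continuous_intros) (use that in auto)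
      qed
      have "continuous_on ((?I \<times> ?I) \<times> ?I) (\<lambda>(z, s). area_r (fst z) (snd z) s)"
        unfolding split_beta by (intro continuous_on_area continuous_intros) auto
      from integral_continuous_on_param[OF this]
      show "continuous_on (?I \<times> ?I) (\<lambda>(r, t). integral ?I (area_r r t))"
        by (simp add: split_beta)
    qed (use r in auto)
    ultimately show ?thesis by simp
  qed
  also have "integral ?I (\<lambda>t. integral ?I (area_r r t)) = integral ?I (\<lambda>t. \<Omega> (g r t) (g\<^sub>r r t) (g\<^sub>t r t))"
  proof -
    have "(\<lambda>t. \<Omega> (g r t) (g\<^sub>r r t) (g\<^sub>t r t)) integrable_on ?I"
      by (intro integrable_continuous continuous_on_area(5)[of _ _ id] continuous_intros) (use r in auto)
    then have "integral ?I (\<lambda>t. \<Omega> (g r t) (g\<^sub>r r t) (g\<^sub>t r t) + integral ?I (area_t r t))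
        = integral ?I (\<lambda>t. \<Omega> (g r t) (g\<^sub>r r t) (g\<^sub>t r t))"
      using \<beta>int by (simp add: integral_add)
    moreover have "integral ?I (\<lambda>t. integral ?I (area_r r t))
        = integral ?I (\<lambda>t. \<Omega> (g r t) (g\<^sub>r r t) (g\<^sub>t r t) + integral ?I (area_t r t))"
      by (intro integral_cong) (use diff in \<open>force simp: algebra_simps\<close>)
    ultimately show ?thesis by simp
  qed
  finally show ?thesis by simp
qed

end

section \<open>The isoperimetric estimate\<close>

lemma integral_square_le:
  fixes a :: "real \<Rightarrow> real"
  assumes a: "continuous_on {0..1} a"
  shows "(integral {0..1} a)\<^sup>2 \<le> integral {0..1} (\<lambda>t. (a t)\<^sup>2)"
proof -
  define m where "m = integral {0..1} a"
  have i: "a integrable_on {0..1}" "(\<lambda>t. (a t)\<^sup>2) integrable_on {0..1}"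
    using a by (auto intro!: integrable_continuous_real continuous_intros)
  have "0 \<le> integral {0..1} (\<lambda>t. (a t - m)\<^sup>2)"
    by (intro integral_nonneg integrable_continuous_real continuous_intros a) auto
  also have "(\<lambda>t. (a t - m)\<^sup>2) = (\<lambda>t. (a t)\<^sup>2 - (2 * m * a t - m\<^sup>2))"
    by (auto simp: power2_diff)
  also have "integral {0..1} \<dots> = integral {0..1} (\<lambda>t. (a t)\<^sup>2) - (2 * m * m - m\<^sup>2)"
  proof -
    have "(\<lambda>t. 2 * m * a t) integrable_on {0..1}"
      using i(1) by (intro integrable_on_mult_right)
    moreover have "(\<lambda>t. m\<^sup>2) integrable_on {0..1::real}" by (rule integrable_const_ivl)
    ultimately show ?thesis
      using i by (simp add: integral_diff integrable_diff m_def)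
  qed
  finally show ?thesis
    by (simp add: m_def power2_eq_square)
qed

context loop_family
begin

text \<open>The height of the cone is at most the length \<open>L\<close> of the loop, so the area is at most \<open>B L\<^sup>2\<close>,
  and Cauchy-Schwarz bounds \<open>L\<^sup>2\<close> by the energy of the loop.\<close>

lemma cone_area_bound:
  assumes B: "\<And>y u v. y \<in> W \<Longrightarrow> \<bar>\<Omega> y u v\<bar> \<le> B * norm u * norm v" and "0 \<le> B" and r: "r \<in> {0..1}"
  shows "\<bar>cone_area r\<bar> \<le> B * integral {0..1} (\<lambda>t. (norm (g\<^sub>t r t))\<^sup>2)"
proof -
  let ?n = "\<lambda>t. norm (g\<^sub>t r t)"
  define M where "M = integral {0..1} ?n"
  have ct: "continuous_on {0..1} (\<lambda>t. g\<^sub>t r t)"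
    by (rule continuous_on_cone(6)[of _ "\<lambda>t. r" id]) (use r in \<open>auto intro!: continuous_intros\<close>)
  have n: "continuous_on {0..1} ?n" using ct by (intro continuous_intros)
  have height: "norm (cone\<^sub>s r t) \<le> M" if t: "t \<in> {0..1}" for t
  proof -
    have "((\<lambda>t. g\<^sub>t r t) has_integral (g r t - g r 0)) {0..t}"
      by (rule fundamental_theorem_of_calculus)
         (use t r in \<open>auto intro: has_vector_derivative_within_subset[OF g_t]\<close>)
    then have "cone\<^sub>s r t = integral {0..t} (\<lambda>t. g\<^sub>t r t)"
      using r by (simp add: cone\<^sub>s_def integral_unique loop_start)
    also have "norm \<dots> \<le> integral {0..t} ?n"
      by (rule integral_norm_bound_integral)
         (use t in \<open>auto intro!: integrable_continuous_real continuous_on_subset[OF ct] continuous_on_subset[OF n]\<close>)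
    also have "\<dots> \<le> M"
      unfolding M_def
      by (rule integral_subset_le)
         (use t n in \<open>auto intro!: integrable_continuous_real continuous_on_subset[OF n]\<close>)
    finally show ?thesis .
  qed
  have inner: "norm (integral {0..1} (\<lambda>s. \<Omega> (cone r s t) (cone\<^sub>s r t) (s *\<^sub>R g\<^sub>t r t))) \<le> B * M * ?n t"
    if t: "t \<in> {0..1}" for t
  proof -
    have "norm (integral {0..1} (\<lambda>s. \<Omega> (cone r s t) (cone\<^sub>s r t) (s *\<^sub>R g\<^sub>t r t)))
        \<le> integral {0..1} (\<lambda>s::real. B * M * ?n t)"
    proof (rule integral_norm_bound_integral)
      show "(\<lambda>s. \<Omega> (cone r s t) (cone\<^sub>s r t) (s *\<^sub>R g\<^sub>t r t)) integrable_on {0..1}"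
        by (intro integrable_continuous_real continuous_on_area continuous_intros) (use r t in auto)
      fix s :: real assume s: "s \<in> {0..1}"
      have "cone r s t = (1 - s) *\<^sub>R (q + r *\<^sub>R x) + s *\<^sub>R g r t"
        by (simp add: cone_def algebra_simps)
      also have "\<dots> \<in> W"
        using r s t base_in loop_in by (intro convexD[OF W(1)]) auto
      finally have "\<bar>\<Omega> (cone r s t) (cone\<^sub>s r t) (s *\<^sub>R g\<^sub>t r t)\<bar>
          \<le> B * norm (cone\<^sub>s r t) * norm (s *\<^sub>R g\<^sub>t r t)" by (rule B)
      also have "\<dots> \<le> B * M * ?n t"
        using s height[OF t] \<open>0 \<le> B\<close> order_trans[OF norm_ge_zero height[OF t]]
        by (intro mult_mono) (auto simp: mult_left_le_one_le)
      finally show "norm (\<Omega> (cone r s t) (cone\<^sub>s r t) (s *\<^sub>R g\<^sub>t r t)) \<le> B * M * ?n t" by simp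
    qed auto
    then show ?thesis by simp
  qed
  have "norm (cone_area r) \<le> integral {0..1} (\<lambda>t. B * M * ?n t)"
    unfolding cone_area_def
  proof (rule integral_norm_bound_integral)
    have "(\<lambda>t. integral (cbox 0 1) (\<lambda>s. \<Omega> (cone r s t) (cone\<^sub>s r t) (s *\<^sub>R g\<^sub>t r t))) integrable_on cbox 0 1"
    proof (intro integrable_continuous integral_continuous_on_param)
      show "continuous_on (cbox 0 1 \<times> cbox 0 1) (\<lambda>(t, s). \<Omega> (cone r s t) (cone\<^sub>s r t) (s *\<^sub>R g\<^sub>t r t))"
        unfolding split_beta by (intro continuous_on_area continuous_intros) (use r in auto)
    qed
    then show "(\<lambda>t. integral {0..1} (\<lambda>s. \<Omega> (cone r s t) (cone\<^sub>s r t) (s *\<^sub>R g\<^sub>t r t))) integrable_on {0..1}"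
      by simp
    show "(\<lambda>t. B * M * ?n t) integrable_on {0..1}"
      by (intro integrable_continuous_real continuous_intros n)
  qed (rule inner)
  also have "\<dots> = B * M\<^sup>2"
    by (simp add: M_def power2_eq_square)
  also have "\<dots> \<le> B * integral {0..1} (\<lambda>t. (?n t)\<^sup>2)"
    unfolding M_def using \<open>0 \<le> B\<close> by (intro mult_left_mono integral_square_le n)
  finally show ?thesis by simp
qed

text \<open>If the loops are orbits of the Hamiltonians \<open>h t\<close>, then the integral of \<open>h\<close> along the orbit and
  the area have opposite \<open>r\<close>-derivatives: the symplectic action is constant on a connected family
  of closed orbits, being stationary at each of them. At \<open>r = 0\<close> both quantities vanish.\<close>

lemma action_balance:
  assumes h: "\<And>r t. r \<in> {0..1} \<Longrightarrow> t \<in> {0..1} \<Longrightarrow>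
        (h t has_derivative (\<lambda>v. \<Omega> (g r t) (g\<^sub>t r t) v)) (at (g r t))"
    and cont: "continuous_on ({0..1} \<times> {0..1}) (\<lambda>(r, t). h t (g r t))"
    and h0: "\<And>t. t \<in> {0..1} \<Longrightarrow> h t q = 0"
    and r: "r \<in> {0..1}"
  shows "integral {0..1} (\<lambda>t. h t (g r t)) = - cone_area r"
proof -
  let ?I = "cbox (0::real) 1"
  have hd: "((\<lambda>r. h t (g r t)) has_vector_derivative - \<Omega> (g r t) (g\<^sub>r r t) (g\<^sub>t r t)) (at r within {0..1})"
    if "r \<in> {0..1}" "t \<in> {0..1}" for r t
  proof -
    have "g r t \<in> V" using that loop_in W(2) by blast
    then show ?thesis
      using vector_derivative_diff_chain_within[OF g_r has_derivative_at_withinI[OF h], OF that that]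
        form_swap[of "g r t" "g\<^sub>t r t" "g\<^sub>r r t"] by (simp add: o_def)
  qed
  have "((\<lambda>r. integral ?I (\<lambda>t. h t (g r t))) has_vector_derivative
      integral ?I (\<lambda>t. - \<Omega> (g r t) (g\<^sub>r r t) (g\<^sub>t r t))) (at r within {0..1})" if "r \<in> {0..1}" for r
  proof (rule leibniz_rule_vector_derivative)
    show "(\<lambda>t. h t (g r t)) integrable_on ?I" if "r \<in> {0..1}" for r
      by (intro integrable_continuous continuous_on_compose2[OF cont, where f="Pair r", unfolded split_beta fst_conv snd_conv] continuous_intros)
         (use that in auto)
    show "continuous_on ({0..1} \<times> ?I) (\<lambda>(r, t). - \<Omega> (g r t) (g\<^sub>r r t) (g\<^sub>t r t))"
      unfolding split_beta by (intro continuous_intros continuous_on_area(5)[of _ _ "\<lambda>_. 0"]) auto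
  qed (use hd that in auto)
  from has_vector_derivative_add[OF this cone_area_deriv]
  have "((\<lambda>r. integral {0..1} (\<lambda>t. h t (g r t)) + cone_area r) has_vector_derivative 0) (at r within {0..1})"
    if "r \<in> {0..1}" for r using that by simp
  then have "integral {0..1} (\<lambda>t. h t (g r t)) + cone_area r
      = integral {0..1} (\<lambda>t. h t (g 0 t)) + cone_area 0"
    using r by (intro has_derivative_zero_unique[of "{0..1}" _ r 0]) (auto simp: has_vector_derivative_def)
  also have "integral {0..1} (\<lambda>t. h t (g 0 t)) = integral {0..1} (\<lambda>t::real. 0)"
    by (intro integral_cong) (simp add: loop_constant h0)
  also have "cone_area 0 = integral {0..1} (\<lambda>t::real. integral {0..1} (\<lambda>s::real. 0))"
    unfolding cone_area_def
    by (intro integral_cong) (use cone_in in \<open>simp add: cone\<^sub>s_def loop_constant\<close>)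
  finally show ?thesis by simp
qed

text \<open>For \<open>k = - h \<ge> 0\<close> along an orbit, the action balance and the
  isoperimetric estimate give \<open>\<integral> k = area \<le> B \<integral> |g\<^sub>t|\<^sup>2 \<le> B c \<integral> k\<close>. Since \<open>B c < 1\<close>, the integral
  of \<open>k\<close> is zero.\<close>

lemma semidefinite_loop_rigidity:
  assumes B: "\<And>y u v. y \<in> W \<Longrightarrow> \<bar>\<Omega> y u v\<bar> \<le> B * norm u * norm v" and "0 \<le> B"
    and h: "\<And>r t. r \<in> {0..1} \<Longrightarrow> t \<in> {0..1} \<Longrightarrow>
        (h t has_derivative (\<lambda>v. \<Omega> (g r t) (g\<^sub>t r t) v)) (at (g r t))"
    and cont: "continuous_on ({0..1} \<times> {0..1}) (\<lambda>(r, t). h t (g r t))"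
    and h0: "\<And>t. t \<in> {0..1} \<Longrightarrow> h t q = 0"
    and neg: "\<And>r t. r \<in> {0..1} \<Longrightarrow> t \<in> {0..1} \<Longrightarrow> h t (g r t) \<le> 0"
    and speed: "\<And>r t. r \<in> {0..1} \<Longrightarrow> t \<in> {0..1} \<Longrightarrow> (norm (g\<^sub>t r t))\<^sup>2 \<le> c * - h t (g r t)"
    and small: "B * c < 1"
    and rt: "r \<in> {0..1}" "t \<in> {0..1}"
  shows "h t (g r t) = 0"
proof -
  let ?k = "\<lambda>t. - h t (g r t)"
  have k: "continuous_on {0..1} ?k"
    by (intro continuous_intros continuous_on_compose2[OF cont, where f="Pair r", unfolded split_beta fst_conv snd_conv])
       (use rt in auto)
  have n: "continuous_on {0..1} (\<lambda>t. (norm (g\<^sub>t r t))\<^sup>2)"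
    by (intro continuous_intros continuous_on_cone(6)[of _ "\<lambda>t. r" "\<lambda>t. 0" "\<lambda>t. t"]) (use rt in auto)
  have "integral {0..1} ?k = cone_area r"
    using action_balance[OF h cont h0 rt(1)] by simp
  also have "\<dots> \<le> B * integral {0..1} (\<lambda>t. (norm (g\<^sub>t r t))\<^sup>2)"
    using cone_area_bound[OF B \<open>0 \<le> B\<close> rt(1)] by linarith
  also have "\<dots> \<le> B * integral {0..1} (\<lambda>t. c * ?k t)"
    by (intro mult_left_mono integral_le integrable_continuous_real n continuous_intros k)
       (use speed rt \<open>0 \<le> B\<close> in auto)
  also have "\<dots> = B * c * integral {0..1} ?k"
    by simp
  finally have "(1 - B * c) * integral {0..1} ?k \<le> 0"
    by (simp add: algebra_simps)
  then have "integral {0..1} ?k \<le> 0"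
    unfolding mult_le_0_iff using small by argo
  moreover have "0 \<le> integral {0..1} ?k"
    by (intro integral_nonneg integrable_continuous_real k) (use neg rt in auto)
  ultimately show ?thesis
    using integral_eq_0_iff[OF k] neg rt by force
qed

end

section \<open>Gradients, second derivatives and compactness\<close>

text \<open>A nonnegative function with small second derivative has a gradient that is small compared with
  the square root of the function: a descent step of length \<open>|a y| / (2 \<epsilon>)\<close> from \<open>y\<close> would make
  the function negative otherwise. The critical point \<open>q\<close> keeps this step inside the larger ball,
  since \<open>|a y| \<le> \<epsilon> |y - q|\<close>.\<close>

lemma gradient_square_le:
  fixes k :: "'e::euclidean_space \<Rightarrow> real" and a :: "'e \<Rightarrow> 'e"
  assumes der: "\<And>y. y \<in> ball q (2 * \<delta>) \<Longrightarrow> (k has_derivative (\<lambda>v. a y \<bullet> v)) (at y)"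
    and lip: "\<And>y z. y \<in> ball q (2 * \<delta>) \<Longrightarrow> z \<in> ball q (2 * \<delta>) \<Longrightarrow> norm (a y - a z) \<le> \<epsilon> * norm (y - z)"
    and pos: "\<And>y. y \<in> ball q (2 * \<delta>) \<Longrightarrow> 0 \<le> k y"
    and a0: "a q = 0" and "\<epsilon> > 0" and y: "y \<in> ball q \<delta>"
  shows "(norm (a y))\<^sup>2 \<le> 4 * \<epsilon> * k y"
proof -
  define v where "v = - (1 / (2 * \<epsilon>)) *\<^sub>R a y"
  have y2: "y \<in> ball q (2 * \<delta>)" "q \<in> ball q (2 * \<delta>)"
    using y zero_le_dist[of q y] unfolding mem_ball dist_self by linarith+
  have "norm (a y) \<le> \<epsilon> * norm (y - q)" using lip[OF y2] a0 by simp
  then have nv: "norm v \<le> norm (y - q)"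
  proof -
    have "norm v = norm (a y) / (2 * \<epsilon>)" using \<open>\<epsilon> > 0\<close> by (simp add: v_def)
    also have "\<dots> \<le> \<epsilon> * norm (y - q) / (2 * \<epsilon>)"
      using \<open>norm (a y) \<le> \<epsilon> * norm (y - q)\<close> \<open>\<epsilon> > 0\<close> by (intro divide_right_mono) auto
    also have "\<dots> \<le> norm (y - q)" using \<open>\<epsilon> > 0\<close> by simp
    finally show ?thesis .
  qed
  have in_ball: "y + s *\<^sub>R v \<in> ball q (2 * \<delta>)" if "s \<in> {0..1}" for s
  proof -
    have "norm (s *\<^sub>R v) \<le> norm v" using that by (simp add: mult_left_le_one_le)
    moreover have "norm ((y - q) + s *\<^sub>R v) \<le> norm (y - q) + norm (s *\<^sub>R v)"
      by (rule norm_triangle_ineq)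
    ultimately have "norm (y + s *\<^sub>R v - q) < 2 * \<delta>"
      using nv y by (simp add: dist_norm norm_minus_commute algebra_simps)
    then show ?thesis by (simp add: dist_norm norm_minus_commute)
  qed
  have "\<exists>\<xi>\<in>{0..1}. k (y + 1 *\<^sub>R v) - k (y + 0 *\<^sub>R v) = (\<lambda>h. h * (a (y + \<xi> *\<^sub>R v) \<bullet> v)) (1 - 0)"
  proof (rule mvt_very_simple)
    fix s :: real assume "0 \<le> s" "s \<le> 1"
    then have "((\<lambda>s. k (y + s *\<^sub>R v)) has_vector_derivative a (y + s *\<^sub>R v) \<bullet> v) (at s within {0..1})"
      using der in_ball by (intro has_vector_derivative_along_line) auto
    then show "((\<lambda>s. k (y + s *\<^sub>R v)) has_derivative (\<lambda>h. h * (a (y + s *\<^sub>R v) \<bullet> v))) (at s within {0..1})"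
      by (simp add: has_vector_derivative_def)
  qed simp
  then obtain \<xi> where \<xi>: "\<xi> \<in> {0..1}" "k (y + v) - k y = a (y + \<xi> *\<^sub>R v) \<bullet> v" by auto
  have "(a (y + \<xi> *\<^sub>R v) - a y) \<bullet> v \<le> norm (a (y + \<xi> *\<^sub>R v) - a y) * norm v"
    by (rule norm_cauchy_schwarz)
  also have "\<dots> \<le> \<epsilon> * norm (y + \<xi> *\<^sub>R v - y) * norm v"
    by (intro mult_right_mono lip in_ball \<xi> y2) simp
  also have "\<dots> \<le> \<epsilon> * norm v * norm v"
    using \<xi> \<open>\<epsilon> > 0\<close> by (intro mult_right_mono mult_left_mono) (auto simp: mult_left_le_one_le)
  also have "\<dots> = (norm (a y))\<^sup>2 / (4 * \<epsilon>)"
    using \<open>\<epsilon> > 0\<close> by (simp add: v_def power2_eq_square)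
  finally have "k (y + v) \<le> k y + a y \<bullet> v + (norm (a y))\<^sup>2 / (4 * \<epsilon>)"
    using \<xi>(2) by (simp add: inner_diff_left)
  moreover have "a y \<bullet> v = - (norm (a y))\<^sup>2 / (2 * \<epsilon>)"
    by (simp add: v_def power2_norm_eq_inner)
  moreover have "0 \<le> k (y + v)" using pos in_ball[of 1] by simp
  ultimately have "(norm (a y))\<^sup>2 / (2 * \<epsilon>) - (norm (a y))\<^sup>2 / (4 * \<epsilon>) \<le> k y" by simp
  then show ?thesis
    using \<open>\<epsilon> > 0\<close> by (simp add: field_simps)
qed

definition grad :: "(real \<times> 'e::euclidean_space \<Rightarrow> real) \<Rightarrow> real \<times> 'e \<Rightarrow> 'e" where
  "grad h p = (\<Sum>b\<in>Basis. space_deriv b h p *\<^sub>R b)"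

lemma space_deriv_eq_grad:
  assumes "smooth_on ({0..1} \<times> V) h" "open V" "t \<in> {0..1}" "y \<in> V"
  shows "space_deriv v h (t, y) = grad h (t, y) \<bullet> v"
proof -
  have L: "linear (\<lambda>v. space_deriv v h (t, y))"
    using has_derivative_space_deriv[OF assms] by (rule has_derivative_linear)
  have "space_deriv v h (t, y) = (\<Sum>b\<in>Basis. space_deriv ((v \<bullet> b) *\<^sub>R b) h (t, y))"
    using linear_sum[OF L, of "\<lambda>b. (v \<bullet> b) *\<^sub>R b" Basis] by (simp add: euclidean_representation)
  also have "\<dots> = grad h (t, y) \<bullet> v"
    unfolding grad_def inner_sum_left
    by (intro sum.cong) (simp_all add: linear_scale[OF L] inner_commute)
  finally show ?thesis .
qed

lemma grad_lipschitz:
  fixes h :: "real \<times> 'e::euclidean_space \<Rightarrow> real"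
  assumes h: "smooth_on ({0..1} \<times> V) h" and V: "open V" and t: "t \<in> {0..1}"
    and K: "convex K" "K \<subseteq> V"
    and bound: "\<And>y i j. y \<in> K \<Longrightarrow> i \<in> Basis \<Longrightarrow> j \<in> Basis \<Longrightarrow>
      \<bar>space_deriv j (space_deriv i h) (t, y)\<bar> \<le> \<eta>"
    and yz: "y \<in> K" "z \<in> K"
  shows "norm (grad h (t, y) - grad h (t, z)) \<le> real DIM('e) * (real DIM('e) * \<eta>) * norm (y - z)"
proof -
  have comp: "\<bar>space_deriv i h (t, y) - space_deriv i h (t, z)\<bar> \<le> real DIM('e) * \<eta> * norm (y - z)"
    if i: "i \<in> Basis" for i
  proof -
    have si: "smooth_on ({0..1} \<times> V) (space_deriv i h)"
      using h V by (rule smooth_on_space_deriv)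
    have "norm (space_deriv i h (t, y) - space_deriv i h (t, z)) \<le> real DIM('e) * \<eta> * norm (y - z)"
    proof (rule differentiable_bound[OF K(1) _ _ yz, where f="\<lambda>y. space_deriv i h (t, y)"
          and f'="\<lambda>u v. space_deriv v (space_deriv i h) (t, u)"])
      fix u assume u: "u \<in> K"
      then show "((\<lambda>y. space_deriv i h (t, y)) has_derivative (\<lambda>v. space_deriv v (space_deriv i h) (t, u))) (at u within K)"
        using K t by (blast intro: has_derivative_at_withinI[OF has_derivative_space_deriv[OF si V]])
      show "onorm (\<lambda>v. space_deriv v (space_deriv i h) (t, u)) \<le> real DIM('e) * \<eta>"
      proof (rule onorm_le)
        fix v
        have "norm (space_deriv v (space_deriv i h) (t, u))
            = \<bar>\<Sum>j\<in>Basis. space_deriv j (space_deriv i h) (t, u) * (j \<bullet> v)\<bar>"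
          using u K t by (subst space_deriv_eq_grad[OF si V]) (auto simp: grad_def inner_sum_left)
        also have "\<dots> \<le> (\<Sum>j\<in>(Basis::'e set). \<eta> * norm v)"
        proof (intro order_trans[OF sum_abs] sum_mono)
          fix j :: 'e assume j: "j \<in> Basis"
          have "\<bar>j \<bullet> v\<bar> \<le> norm v" using Basis_le_norm[OF j, of v] by (simp add: inner_commute)
          then show "\<bar>space_deriv j (space_deriv i h) (t, u) * (j \<bullet> v)\<bar> \<le> \<eta> * norm v"
            unfolding abs_mult using bound[OF u i j] by (intro mult_mono) auto
        qed
        finally show "norm (space_deriv v (space_deriv i h) (t, u)) \<le> real DIM('e) * \<eta> * norm v" by simp
      qed
    qed
    then show ?thesis by simp
  qed
  have "grad h (t, y) - grad h (t, z) = (\<Sum>i\<in>Basis. (space_deriv i h (t, y) - space_deriv i h (t, z)) *\<^sub>R i)"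
    by (simp add: grad_def sum_subtractf scaleR_diff_left)
  also have "norm \<dots> \<le> (\<Sum>i\<in>(Basis::'e set). real DIM('e) * \<eta> * norm (y - z))"
    by (intro sum_norm_le) (use comp in simp)
  finally show ?thesis by simp
qed

lemma continuous_on_second_deriv:
  assumes "smooth_on ({0..1} \<times> V) h" "open V" "K \<subseteq> V"
  shows "continuous_on ({0..1} \<times> K) (space_deriv w (space_deriv v h))"
proof -
  have "smooth_on ({0..1} \<times> V) (space_deriv w (space_deriv v h))"
    using assms by (intro smooth_on_space_deriv)
  then show ?thesis
    using assms(3) by (intro continuous_on_subset[OF smooth_on_imp_continuous_on]) auto
qed

lemma second_deriv_bounded:
  fixes h :: "real \<times> 'e::euclidean_space \<Rightarrow> real"
  assumes h: "smooth_on ({0..1} \<times> V) h" and V: "open V" and K: "compact K" "K \<subseteq> V"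
  shows "\<exists>\<eta>\<ge>0. \<forall>t\<in>{0..1}. \<forall>y\<in>K. \<forall>i\<in>Basis. \<forall>j\<in>Basis. \<bar>space_deriv j (space_deriv i h) (t, y)\<bar> \<le> \<eta>"
proof -
  define F where "F = (\<lambda>p. \<Sum>i\<in>Basis. \<Sum>j\<in>Basis. \<bar>space_deriv j (space_deriv i h) p\<bar>)"
  have "continuous_on ({0..1} \<times> K) F"
    unfolding F_def
    by (intro continuous_intros continuous_on_second_deriv[OF h V K(2)])
  moreover have "compact ({0..1::real} \<times> K)" using K by (intro compact_Times) auto
  ultimately have "bounded (F ` ({0..1} \<times> K))"
    by (intro compact_imp_bounded compact_continuous_image)
  then obtain \<eta> where \<eta>: "\<And>p. p \<in> {0..1} \<times> K \<Longrightarrow> \<bar>F p\<bar> \<le> \<eta>"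
    unfolding bounded_iff by force
  show ?thesis
  proof (intro exI[of _ "\<bar>\<eta>\<bar>"] conjI ballI)
    fix t :: real and y i j :: 'e assume A: "t \<in> {0..1}" "y \<in> K" "i \<in> Basis" "j \<in> Basis"
    have "\<bar>space_deriv j (space_deriv i h) (t, y)\<bar> \<le> (\<Sum>j\<in>Basis. \<bar>space_deriv j (space_deriv i h) (t, y)\<bar>)"
      using A by (intro member_le_sum[of j]) auto
    also have "\<dots> \<le> F (t, y)"
      unfolding F_def using A by (intro member_le_sum[of i]) (auto intro: sum_nonneg)
    also have "\<dots> \<le> \<bar>\<eta>\<bar>" using \<eta>[of "(t, y)"] A by auto
    finally show "\<bar>space_deriv j (space_deriv i h) (t, y)\<bar> \<le> \<bar>\<eta>\<bar>" .
  qed simp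
qed

text \<open>Uniformity in time comes from the compactness of \<open>[0,1]\<close>, through uniform continuity on
  \<open>[0,1] \<times> cball q \<rho>\<close>.\<close>

lemma second_deriv_small:
  fixes h :: "real \<times> 'e::euclidean_space \<Rightarrow> real"
  assumes h: "smooth_on ({0..1} \<times> V) h" and V: "open V" and q: "q \<in> V"
    and zero: "\<And>t i j. t \<in> {0..1} \<Longrightarrow> space_deriv j (space_deriv i h) (t, q) = 0" and "\<eta> > 0"
  shows "\<exists>\<delta>>0. ball q \<delta> \<subseteq> V \<and> (\<forall>t\<in>{0..1}. \<forall>y\<in>ball q \<delta>. \<forall>i\<in>Basis. \<forall>j\<in>Basis.
    \<bar>space_deriv j (space_deriv i h) (t, y)\<bar> \<le> \<eta>)"
proof -
  obtain \<rho> where \<rho>: "\<rho> > 0" "cball q \<rho> \<subseteq> V" using V q open_contains_cball by blast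
  let ?F = "\<lambda>p. \<Sum>i\<in>(Basis::'e set). \<Sum>j\<in>(Basis::'e set). \<bar>space_deriv j (space_deriv i h) p\<bar>"
  have c: "continuous_on ({0..1} \<times> cball q \<rho>) ?F"
    by (intro continuous_intros continuous_on_second_deriv[OF h V \<rho>(2)])
  have "compact ({0..1::real} \<times> cball q \<rho>)" by (intro compact_Times) auto
  with c have "uniformly_continuous_on ({0..1} \<times> cball q \<rho>) ?F"
    by (rule compact_uniformly_continuous)
  then obtain d where d: "d > 0" "\<And>p p'. p \<in> {0..1} \<times> cball q \<rho> \<Longrightarrow> p' \<in> {0..1} \<times> cball q \<rho> \<Longrightarrow>
      dist p' p < d \<Longrightarrow> dist (?F p') (?F p) < \<eta>"
    using \<open>\<eta> > 0\<close> unfolding uniformly_continuous_on_def by metis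
  have "\<bar>space_deriv j (space_deriv i h) (t, y)\<bar> \<le> \<eta>"
    if A: "t \<in> {0..1}" "y \<in> ball q (min d \<rho>)" "i \<in> Basis" "j \<in> Basis" for t y i j
  proof -
    have "?F (t, q) = 0" using zero A by simp
    moreover have "dist (?F (t, y)) (?F (t, q)) < \<eta>"
      using A \<rho> by (intro d(2)) (auto simp: dist_Pair_Pair dist_commute)
    ultimately have "?F (t, y) < \<eta>" by (simp add: dist_real_def)
    moreover have "\<bar>space_deriv j (space_deriv i h) (t, y)\<bar> \<le> (\<Sum>j\<in>Basis. \<bar>space_deriv j (space_deriv i h) (t, y)\<bar>)"
      using A by (intro member_le_sum[of j]) auto
    moreover have "\<dots> \<le> ?F (t, y)"
      using A by (intro member_le_sum[of i]) (auto intro: sum_nonneg)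
    ultimately show ?thesis by linarith
  qed
  then show ?thesis
    using d(1) \<rho> by (intro exI[of _ "min d \<rho>"]) auto
qed

context closed_form_on_open
begin

lemma form_bounded_on_compact:
  assumes K: "compact K" "K \<subseteq> V"
  shows "\<exists>B\<ge>0. \<forall>y\<in>K. \<forall>u v. \<bar>\<Omega> y u v\<bar> \<le> B * norm u * norm v"
proof -
  define F where "F = (\<lambda>y. \<Sum>i\<in>Basis. \<Sum>j\<in>Basis. \<bar>\<Omega> y i j\<bar>)"
  have "continuous_on K F"
    unfolding F_def by (intro continuous_intros continuous_on_form) (use K in auto)
  then have "bounded (F ` K)"
    using K by (intro compact_imp_bounded compact_continuous_image)
  then obtain B where B: "\<And>y. y \<in> K \<Longrightarrow> \<bar>F y\<bar> \<le> B"
    unfolding bounded_iff by force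
  show ?thesis
  proof (intro exI[of _ "\<bar>B\<bar>"] conjI ballI allI)
    fix y u v assume y: "y \<in> K"
    have "\<bar>\<Omega> y u v\<bar> \<le> (\<Sum>i\<in>Basis. \<Sum>j\<in>Basis. norm u * norm v * \<bar>\<Omega> y i j\<bar>)"
    proof -
      have "\<Omega> y u v = (\<Sum>i\<in>Basis. \<Sum>j\<in>Basis. (u \<bullet> i) * (v \<bullet> j) * \<Omega> y i j)"
        using y K by (intro form_expand) auto
      moreover have "\<bar>(u \<bullet> i) * (v \<bullet> j) * \<Omega> y i j\<bar> \<le> norm u * norm v * \<bar>\<Omega> y i j\<bar>"
        if "i \<in> Basis" "j \<in> Basis" for i j
        unfolding abs_mult using that by (intro mult_mono Basis_le_norm) auto
      ultimately show ?thesis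
        by (auto intro!: order_trans[OF sum_abs] sum_mono)
    qed
    also have "\<dots> = F y * (norm u * norm v)"
      by (simp add: F_def sum_distrib_left sum_distrib_right mult_ac)
    also have "\<dots> \<le> \<bar>B\<bar> * (norm u * norm v)"
      using B[OF y] by (intro mult_right_mono) auto
    finally show "\<bar>\<Omega> y u v\<bar> \<le> \<bar>B\<bar> * norm u * norm v" by (simp add: mult_ac)
  qed simp
qed

text \<open>On a compact set a nondegenerate form bounds a vector by the covector it represents, so a
  Hamiltonian vector field is bounded by the gradient of its Hamiltonian. The constant is the
  inverse of the minimum of \<open>|\<Omega> y u|\<close> over \<open>y\<close> in the set and unit vectors \<open>u\<close>.\<close>

lemma nondegenerate_on_compact:
  assumes K: "compact K" "K \<subseteq> V"
    and nondeg: "\<And>y u. y \<in> K \<Longrightarrow> (\<And>v. \<Omega> y u v = 0) \<Longrightarrow> u = 0"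
  shows "\<exists>m>0. \<forall>y\<in>K. \<forall>u a. (\<forall>v. \<Omega> y u v = a \<bullet> v) \<longrightarrow> norm u \<le> m * norm a"
proof (cases "K = {}")
  case False
  define F where "F = (\<lambda>(y, u). norm (\<Sum>b\<in>Basis. \<Omega> y u b *\<^sub>R b))"
  have F: "F (y, u) = norm a" if "\<forall>v. \<Omega> y u v = a \<bullet> v" for y u a
    using that by (simp add: F_def euclidean_representation)
  let ?S = "K \<times> sphere (0::'e) 1"
  have "compact ?S" using K by (intro compact_Times) auto
  moreover have "?S \<noteq> {}"
    using False by (metis Sigma_empty_iff ex_in_conv mem_sphere_0 norm_Basis nonempty_Basis sigma_sets.Empty)
  moreover have "continuous_on ?S F"
    unfolding F_def split_beta by (intro continuous_intros continuous_on_form) (use K in auto)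
  ultimately obtain p where p: "p \<in> ?S" "\<And>p'. p' \<in> ?S \<Longrightarrow> F p \<le> F p'"
    using continuous_attains_inf by metis
  obtain y0 u0 where p0: "p = (y0, u0)" "y0 \<in> K" "norm u0 = 1" using p(1) by auto
  have "F p > 0"
  proof (rule ccontr)
    assume "\<not> F p > 0"
    then have z: "(\<Sum>b\<in>Basis. \<Omega> y0 u0 b *\<^sub>R b) = 0" by (simp add: F_def p0)
    have "\<Omega> y0 u0 b = 0" if "b \<in> Basis" for b
      using arg_cong[OF z, of "\<lambda>x. x \<bullet> b"] that by (simp add: inner_sum_left inner_Basis if_distrib cong: if_cong)
    moreover have "linear (\<Omega> y0 u0)"
      using form_bilinear K p0 unfolding bilinear_def by blast
    ultimately have "\<Omega> y0 u0 = (\<lambda>v. 0)"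
      by (intro linear_eq_stdbasis) (auto simp: linear_iff)
    then show False using nondeg[OF p0(2), of u0] p0(3) by auto
  qed
  show ?thesis
  proof (intro exI[of _ "1 / F p"] conjI ballI allI impI)
    fix y u a assume y: "y \<in> K" and a: "\<forall>v. \<Omega> y u v = a \<bullet> v"
    show "norm u \<le> 1 / F p * norm a"
    proof (cases "u = 0")
      case False
      have "\<forall>v. \<Omega> y (u /\<^sub>R norm u) v = (a /\<^sub>R norm u) \<bullet> v"
        using a y K bilinear_lmul[OF form_bilinear] by (auto simp: subset_iff)
      from F[OF this] have "F (y, u /\<^sub>R norm u) = norm a / norm u" by (simp add: divide_inverse mult.commute)
      moreover have "F p \<le> F (y, u /\<^sub>R norm u)" using y False by (intro p(2)) auto
      ultimately have "F p \<le> norm a / norm u" by simp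
      then have "F p * norm u \<le> norm a" using False by (simp add: pos_le_divide_eq)
      then show ?thesis using \<open>F p > 0\<close> by (simp add: pos_le_divide_eq mult.commute)
    qed (use \<open>F p > 0\<close> in simp)
  qed (use \<open>F p > 0\<close> in simp)
qed (auto intro: exI[of _ 1])

end

section \<open>Charts and tangent vectors\<close>

locale atlas =
  fixes A :: "('m::{t2_space, second_countable_topology}, 'e::euclidean_space) chart set"
  assumes smooth_atlas: "smooth_atlas A"
begin

lemma chart:
  assumes "C \<in> A"
  shows open_cdom: "open (cdom C)" and open_cimage: "open (cimage C)"
    and param_coord: "x \<in> cdom C \<Longrightarrow> param C (coord C x) = x"
    and coord_param: "y \<in> cimage C \<Longrightarrow> coord C (param C y) = y"
    and param_in: "y \<in> cimage C \<Longrightarrow> param C y \<in> cdom C"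
    and continuous_on_coord: "continuous_on (cdom C) (coord C)"
    and continuous_on_param: "continuous_on (cimage C) (param C)"
proof -
  have *: "open (cdom C)" "open (cimage C)" "homeomorphism (cdom C) (cimage C) (coord C) (param C)"
    using smooth_atlas assms unfolding smooth_atlas_def by blast+
  then show "open (cdom C)" "open (cimage C)" by auto
  show "x \<in> cdom C \<Longrightarrow> param C (coord C x) = x" using *(3) by (rule homeomorphism_apply1)
  show "y \<in> cimage C \<Longrightarrow> coord C (param C y) = y" using *(3) by (rule homeomorphism_apply2)
  show "y \<in> cimage C \<Longrightarrow> param C y \<in> cdom C" by (rule inv_into_into)
  show "continuous_on (cdom C) (coord C)" using *(3) by (rule homeomorphism_cont1)
  show "continuous_on (cimage C) (param C)" using *(3) by (rule homeomorphism_cont2)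
qed

lemma chart_at: "chart_at A x \<in> A" "x \<in> cdom (chart_at A x)"
proof -
  have "\<exists>C. C \<in> A \<and> x \<in> cdom C"
    using smooth_atlas unfolding smooth_atlas_def by blast
  then have "chart_at A x \<in> A \<and> x \<in> cdom (chart_at A x)"
    unfolding chart_at_def by (rule someI_ex)
  then show "chart_at A x \<in> A" "x \<in> cdom (chart_at A x)" by auto
qed

lemma open_coord_image:
  assumes "C \<in> A" "open U" "U \<subseteq> cdom C" shows "open (coord C ` U)"
proof -
  have "coord C ` U = cimage C \<inter> param C -` U"
    using assms(3) param_coord[OF assms(1)] coord_param[OF assms(1)] by force
  then show ?thesis
    using continuous_open_preimage[OF continuous_on_param open_cimage] assms by metis
qed

lemma open_overlap:
  "C \<in> A \<Longrightarrow> D \<in> A \<Longrightarrow> open (coord C ` (cdom C \<inter> cdom D))"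
  by (intro open_coord_image open_Int open_cdom) blast+

lemma open_param_image:
  assumes "C \<in> A" "open U" "U \<subseteq> cimage C" shows "open (param C ` U)"
proof -
  have "param C ` U = cdom C \<inter> coord C -` U"
    using assms(3) param_coord[OF assms(1)] coord_param[OF assms(1)] param_in[OF assms(1)]
    by (auto simp: image_iff subset_iff) metis
  then show ?thesis
    using continuous_open_preimage[OF continuous_on_coord open_cdom] assms by metis
qed

lemma transition_has_derivative:
  assumes "C \<in> A" "D \<in> A" "x \<in> cdom C" "x \<in> cdom D"
  shows "((coord D \<circ> param C) has_derivative transition_deriv C D x) (at (coord C x))"
  unfolding transition_deriv_def
proof (rule smooth_on_open_has_derivative)
  show "smooth_on (coord C ` (cdom C \<inter> cdom D)) (coord D \<circ> param C)"
    using smooth_atlas assms unfolding smooth_atlas_def by blast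
  show "open (coord C ` (cdom C \<inter> cdom D))"
    using assms by (intro open_overlap)
qed (use assms in auto)

lemma transition_deriv_comp:
  assumes "C \<in> A" "D \<in> A" "E \<in> A" "x \<in> cdom C" "x \<in> cdom D" "x \<in> cdom E"
  shows "transition_deriv D E x (transition_deriv C D x u) = transition_deriv C E x u"
proof -
  have D: "((coord E \<circ> param D) has_derivative transition_deriv D E x) (at ((coord D \<circ> param C) (coord C x)))"
    using transition_has_derivative[of D E x] assms by (simp add: param_coord)
  have "((coord E \<circ> param D) \<circ> (coord D \<circ> param C) has_derivative
      transition_deriv D E x \<circ> transition_deriv C D x) (at (coord C x))"
    by (rule diff_chain_at[OF transition_has_derivative D]) (use assms in auto)
  then have "((coord E \<circ> param C) has_derivative
      transition_deriv D E x \<circ> transition_deriv C D x) (at (coord C x))"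
    by (rule has_derivative_transform_within_open[where s="coord C ` (cdom C \<inter> cdom D)"])
       (use assms in \<open>auto intro!: open_overlap simp: param_coord\<close>)
  then have "transition_deriv D E x \<circ> transition_deriv C D x = transition_deriv C E x"
    by (rule has_derivative_unique) (use transition_has_derivative assms in auto)
  then show ?thesis by (metis comp_apply)
qed

lemma transition_deriv_self:
  assumes "C \<in> A" "x \<in> cdom C" shows "transition_deriv C C x u = u"
proof -
  have "((\<lambda>y. y) has_derivative transition_deriv C C x) (at (coord C x))"
    by (rule has_derivative_transform_within_open[OF transition_has_derivative, where s="cimage C"])
       (use assms open_cimage in \<open>auto simp: param_coord\<close>)
  then have "transition_deriv C C x = (\<lambda>u. u)"
    using has_derivative_ident by (rule has_derivative_unique)
  then show ?thesis by simp
qed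

lemma coord_vector_self:
  assumes "C \<in> A" "x \<in> cdom C" shows "coord_vector A C x u C = u"
  using assms by (simp add: coord_vector_def transition_deriv_self)

lemma coord_vector_in_tangent_space:
  assumes "C \<in> A" "x \<in> cdom C" shows "coord_vector A C x u \<in> tangent_space A x"
  using assms unfolding tangent_space_def coord_vector_def by (auto simp: transition_deriv_comp)

text \<open>Together with \<open>coord_vector_self\<close>: evaluation in a chart around \<open>x\<close> identifies the tangent
  space at \<open>x\<close> with the model space.\<close>

lemma coord_vector_tangent:
  assumes "C \<in> A" "x \<in> cdom C" "v \<in> tangent_space A x" shows "coord_vector A C x (v C) = v"
proof
  fix D
  show "coord_vector A C x (v C) D = v D"
  proof (cases "D \<in> A \<and> x \<in> cdom D")
    case True
    then have "v D = transition_deriv C D x (v C)"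
      using assms unfolding tangent_space_def by blast
    then show ?thesis using True by (simp add: coord_vector_def)
  next
    case False
    then have "v D = 0" using assms(3) unfolding tangent_space_def by blast
    then show ?thesis using False by (auto simp: coord_vector_def)
  qed
qed

text \<open>The differential is defined through the chosen chart \<open>chart_at A x\<close>; by the chain rule every
  other chart around \<open>x\<close> computes it as well.\<close>

lemma differential_in_chart:
  assumes C: "C \<in> A" "x \<in> cdom C" and v: "v \<in> tangent_space A x"
    and h: "(h \<circ> param C has_derivative h') (at (coord C x))"
  shows "differential A h x v = h' (v C)"
proof -
  define D where "D = chart_at A x"
  have D: "D \<in> A" "x \<in> cdom D" unfolding D_def by (rule chart_at)+
  have "((h \<circ> param C) \<circ> (coord C \<circ> param D) has_derivative h' \<circ> transition_deriv D C x) (at (coord D x))"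
    by (rule diff_chain_at[OF transition_has_derivative]) (use C D h in \<open>auto simp: param_coord\<close>)
  then have "(h \<circ> param D has_derivative h' \<circ> transition_deriv D C x) (at (coord D x))"
    by (rule has_derivative_transform_within_open[where s="coord D ` (cdom D \<inter> cdom C)"])
       (use C D in \<open>auto intro!: open_overlap simp: param_coord\<close>)
  then have "frechet_derivative (h \<circ> param D) (at (coord D x)) = h' \<circ> transition_deriv D C x"
    by (rule frechet_derivative_at[symmetric])
  moreover have "v C = transition_deriv D C x (v D)"
    using v C D unfolding tangent_space_def by blast
  ultimately show ?thesis
    by (simp add: differential_def Let_def D_def)
qed

end

section \<open>The Hamiltonian equation in a chart\<close>

locale symplectic_manifold = atlas A
  for A :: "('m::{t2_space, second_countable_topology}, 'e::euclidean_space) chart set" +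
  fixes \<omega> :: "'m \<Rightarrow> ('m, 'e) tvec \<Rightarrow> ('m, 'e) tvec \<Rightarrow> real"
  assumes symplectic: "symplectic_form A \<omega>"
begin

abbreviation \<Omega> :: "('m, 'e) chart \<Rightarrow> 'e \<Rightarrow> 'e \<Rightarrow> 'e \<Rightarrow> real" where
  "\<Omega> \<equiv> form_in_chart A \<omega>"

lemma closed_form_in_chart:
  assumes C: "C \<in> A"
  shows "closed_form_on_open (cimage C) (\<Omega> C)
    (\<lambda>y w u v. frechet_derivative (\<lambda>z. \<Omega> C z u v) (at y) w)"
proof -
  have smooth: "smooth_on (cimage C) (\<lambda>y. \<Omega> C y u v)" for u v
    using symplectic C unfolding symplectic_form_def smooth_two_form_def by blast
  have bil: "bilinear (\<Omega> C y)" "\<Omega> C y u u = 0" if "y \<in> cimage C" for y u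
    using symplectic C that unfolding symplectic_form_def smooth_two_form_def by blast+
  have closed: "ext_deriv_in_chart A \<omega> C y u v w = 0" if "y \<in> cimage C" for y u v w
    using symplectic C that unfolding symplectic_form_def closed_two_form_def by blast
  show ?thesis
  proof
    show "((\<lambda>z. \<Omega> C z u v) has_derivative (\<lambda>w. frechet_derivative (\<lambda>z. \<Omega> C z u v) (at y) w)) (at y)"
      if "y \<in> cimage C" for y u v
      by (rule smooth_on_open_has_derivative[OF smooth open_cimage[OF C] that])
    show "continuous_on (cimage C) (\<lambda>y. frechet_derivative (\<lambda>z. \<Omega> C z u v) (at y) w)" for w u v
      by (rule smooth_on_imp_continuous_on[OF smooth_on_open_frechet_derivative[OF smooth open_cimage[OF C]]])
  qed (use bil open_cimage[OF C] closed[unfolded ext_deriv_in_chart_def] in auto)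
qed

lemma form_nondegenerate:
  assumes C: "C \<in> A" and y: "y \<in> cimage C" and z: "\<And>v. \<Omega> C y u v = 0"
  shows "u = 0"
proof -
  let ?x = "param C y"
  have x: "?x \<in> cdom C" using C y by (rule param_in)
  have "coord_vector A C ?x u = (\<lambda>C. 0)"
  proof -
    have "\<omega> ?x (coord_vector A C ?x u) v = 0" if v: "v \<in> tangent_space A ?x" for v
      using z[of "v C"] unfolding form_in_chart_def coord_vector_tangent[OF C x v] .
    then show ?thesis
      using symplectic coord_vector_in_tangent_space[OF C x]
      unfolding symplectic_form_def nondegenerate_two_form_def by blast
  qed
  then show ?thesis
    using coord_vector_self[OF C x, of u] by simp
qed

text \<open>Nondegeneracy makes \<open>u \<mapsto> \<Omega> C y u\<close> injective, hence surjective by dimension.\<close>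

lemma form_represents:
  assumes C: "C \<in> A" and y: "y \<in> cimage C" and l: "linear l"
  shows "\<exists>u. \<forall>v. \<Omega> C y u v = l v"
proof -
  interpret closed_form_on_open "cimage C" "\<Omega> C" "\<lambda>y w u v. frechet_derivative (\<lambda>z. \<Omega> C z u v) (at y) w"
    by (rule closed_form_in_chart[OF C])
  have lin: "linear (\<Omega> C y u)" "linear (\<lambda>u. \<Omega> C y u v)" for u v
    using form_bilinear[OF y] unfolding bilinear_def by blast+
  define L where "L = (\<lambda>u. \<Sum>b\<in>Basis. \<Omega> C y u b *\<^sub>R b)"
  have Lb: "L u \<bullet> b = \<Omega> C y u b" if "b \<in> Basis" for u b
    using that by (simp add: L_def inner_sum_left inner_Basis if_distrib cong: if_cong)
  have "linear L"
    unfolding L_def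
    by (intro linearI) (simp_all add: linear_add[OF lin(2)] linear_scale[OF lin(2)] scaleR_add_left
        sum.distrib scaleR_sum_right)
  moreover have "inj L"
  proof (rule linear_injective_0[OF \<open>linear L\<close>, THEN iffD2], intro allI impI)
    fix u assume "L u = 0"
    then have "\<Omega> C y u b = 0" if "b \<in> Basis" for b using Lb[OF that, of u] by simp
    then have "\<Omega> C y u = (\<lambda>v. 0)"
      by (intro linear_eq_stdbasis lin) (auto simp: linear_iff)
    then show "u = 0" using form_nondegenerate[OF C y, of u] by simp
  qed
  ultimately have "surj L" by (rule linear_injective_imp_surjective[OF _ _ refl])
  then obtain u where u: "L u = (\<Sum>b\<in>Basis. l b *\<^sub>R b)" by (metis surjD)
  have "\<Omega> C y u b = l b" if "b \<in> Basis" for b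
    using Lb[OF that, of u] that
    by (simp add: u inner_sum_left inner_Basis if_distrib cong: if_cong)
  then have "\<Omega> C y u = l" by (intro linear_eq_stdbasis lin l)
  then show ?thesis by metis
qed

text \<open>The definite description in \<open>hamiltonian_vector_field\<close> denotes, because existence is
  \<open>form_represents\<close> and uniqueness is nondegeneracy. Hence the defining equation holds in every
  chart.\<close>

lemma hamiltonian_vector_field_in_chart:
  assumes C: "C \<in> A" "x \<in> cdom C" and h: "(h \<circ> param C has_derivative h') (at (coord C x))"
  shows "\<Omega> C (coord C x) (hamiltonian_vector_field A \<omega> h x C) v = h' v"
proof -
  let ?y = "coord C x" and ?X = "hamiltonian_vector_field A \<omega> h x"
  let ?P = "\<lambda>X. X \<in> tangent_space A x \<and> (\<forall>v\<in>tangent_space A x. \<omega> x X v = differential A h x v)"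
  have y: "?y \<in> cimage C" "param C ?y = x" using C param_coord by auto
  interpret closed_form_on_open "cimage C" "\<Omega> C" "\<lambda>y w u v. frechet_derivative (\<lambda>z. \<Omega> C z u v) (at y) w"
    by (rule closed_form_in_chart[OF C(1)])
  have char: "?P X \<longleftrightarrow> X \<in> tangent_space A x \<and> (\<forall>v. \<Omega> C ?y (X C) v = h' v)" for X
  proof (intro conj_cong refl iffI ballI allI)
    fix v assume X: "X \<in> tangent_space A x" and "\<forall>v\<in>tangent_space A x. \<omega> x X v = differential A h x v"
    then have "\<omega> x X (coord_vector A C x v) = h' v"
      using differential_in_chart[OF C coord_vector_in_tangent_space[OF C] h]
        coord_vector_in_tangent_space[OF C] coord_vector_self[OF C] by simp
    then show "\<Omega> C ?y (X C) v = h' v"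
      by (simp add: form_in_chart_def y coord_vector_tangent[OF C X])
  next
    fix v assume X: "X \<in> tangent_space A x" and *: "\<forall>v. \<Omega> C ?y (X C) v = h' v"
      and v: "v \<in> tangent_space A x"
    show "\<omega> x X v = differential A h x v"
      using *[rule_format, of "v C"] differential_in_chart[OF C v h]
      by (simp add: form_in_chart_def y coord_vector_tangent[OF C X] coord_vector_tangent[OF C v])
  qed
  obtain u where u: "\<forall>v. \<Omega> C ?y u v = h' v"
    using form_represents[OF C(1) y(1) has_derivative_linear[OF h]] by blast
  have "?P ?X"
    unfolding hamiltonian_vector_field_def
  proof (rule theI[of ?P "coord_vector A C x u"])
    show "?P (coord_vector A C x u)"
      unfolding char using coord_vector_in_tangent_space[OF C] coord_vector_self[OF C] u by simp
    fix X assume "?P X"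
    then have X: "X \<in> tangent_space A x" "\<forall>v. \<Omega> C ?y (X C) v = h' v" unfolding char by blast+
    have "X C - u = 0"
    proof (rule form_nondegenerate[OF C(1) y(1)])
      show "\<Omega> C ?y (X C - u) v = 0" for v
        using X(2) u bilinear_lsub[OF form_bilinear[OF y(1)]] by simp
    qed
    then show "X = coord_vector A C x u"
      using coord_vector_tangent[OF C X(1)] by simp
  qed
  then show "\<Omega> C ?y (?X C) v = h' v"
    unfolding char by blast
qed

end

section \<open>Fixed global maxima of a Hamiltonian flow\<close>

lemma space_deriv_eq_zero:
  assumes "open S" "y \<in> S" "\<And>z. z \<in> S \<Longrightarrow> f (t, z) = c"
  shows "space_deriv v f (t, y) = 0"
proof -
  have "((\<lambda>z. f (t, z)) has_derivative (\<lambda>_. 0)) (at y)"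
    by (rule has_derivative_transform_within_open[OF has_derivative_const assms(1,2)])
       (use assms(3) in auto)
  from frechet_derivative_at[OF this] show ?thesis
    by (simp add: space_deriv_def fun_eq_iff)
qed

lemma constant_on_closure_point:
  fixes F :: "'a::metric_space \<Rightarrow> 'b::t1_space"
  assumes F: "continuous_on V F" "open V" "q \<in> V"
    and c: "\<And>U. open U \<Longrightarrow> q \<in> U \<Longrightarrow> U \<subseteq> V \<Longrightarrow> \<exists>y\<in>U. F y = c"
  shows "F q = c"
proof (rule ccontr)
  assume "F q \<noteq> c"
  have "open (V \<inter> F -` (- {c}))"
    using F by (intro continuous_open_preimage) auto
  then show False
    using c[of "V \<inter> F -` (- {c})"] F(3) \<open>F q \<noteq> c\<close> by auto
qed

locale hamiltonian_flow_on = symplectic_manifold A \<omega>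
  for A :: "('m::{t2_space, second_countable_topology}, 'e::euclidean_space) chart set"
    and \<omega> :: "'m \<Rightarrow> ('m, 'e) tvec \<Rightarrow> ('m, 'e) tvec \<Rightarrow> real" +
  fixes H :: "real \<Rightarrow> 'm \<Rightarrow> real" and \<phi> :: "real \<Rightarrow> 'm \<Rightarrow> 'm"
  assumes smooth_hamiltonian: "smooth_family_functions A H"
    and flow: "hamiltonian_flow A \<omega> H \<phi>"
begin

text \<open>The Hamiltonian and the flow in the coordinates of a chart. The second is meaningful
  where the flow takes points of the chart back into the chart.\<close>

definition H\<^sub>C :: "('m, 'e) chart \<Rightarrow> real \<times> 'e \<Rightarrow> real" where
  "H\<^sub>C C = (\<lambda>(t, y). H t (param C y))"

definition \<phi>\<^sub>C :: "('m, 'e) chart \<Rightarrow> real \<times> 'e \<Rightarrow> 'e" where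
  "\<phi>\<^sub>C C = (\<lambda>(t, y). coord C (\<phi> t (param C y)))"

lemma smooth_on_H\<^sub>C: "C \<in> A \<Longrightarrow> smooth_on ({0..1} \<times> cimage C) (H\<^sub>C C)"
  using smooth_hamiltonian unfolding smooth_family_functions_def H\<^sub>C_def by blast

lemma flow_0: "\<phi> 0 x = x"
  using flow unfolding hamiltonian_flow_def by simp

lemma continuous_on_flow: "continuous_on ({0..1} \<times> UNIV) (\<lambda>(t, x). \<phi> t x)"
  using flow unfolding hamiltonian_flow_def smooth_family_maps_def by blast

lemma continuous_on_orbit: "continuous_on {0..1} (\<lambda>t. \<phi> t x)"
proof -
  have "continuous_on {0..1} (\<lambda>t::real. (t, x))" by (intro continuous_intros)
  from continuous_on_compose2[OF continuous_on_flow this] show ?thesis by auto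
qed

lemma smooth_on_flow:
  "C \<in> A \<Longrightarrow> D \<in> A \<Longrightarrow>
    smooth_on {(t, y). t \<in> {0..1} \<and> y \<in> cimage C \<and> \<phi> t (param C y) \<in> cdom D}
      (\<lambda>(t, y). coord D (\<phi> t (param C y)))"
  using flow unfolding hamiltonian_flow_def smooth_family_maps_def by blast

lemma smooth_on_\<phi>\<^sub>C:
  assumes "C \<in> A" "U \<subseteq> cimage C" "\<And>t y. t \<in> {0..1} \<Longrightarrow> y \<in> U \<Longrightarrow> \<phi> t (param C y) \<in> cdom C"
  shows "smooth_on ({0..1} \<times> U) (\<phi>\<^sub>C C)"
  unfolding \<phi>\<^sub>C_def
  by (rule smooth_on_subset[OF smooth_on_flow[OF assms(1,1)]]) (use assms in auto)

text \<open>An orbit need not stay in one chart. Smoothness of the flow near the single time \<open>t\<close>, in the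
  charts around \<open>x\<close> and \<open>\<phi> t x\<close>, suffices for its velocity in a chart around \<open>\<phi> t x\<close>.\<close>

lemma orbit_has_vector_derivative:
  assumes D: "D \<in> A" and t: "t \<in> {0..1}" and x: "\<phi> t x \<in> cdom D"
  shows "((\<lambda>s. coord D (\<phi> s x)) has_vector_derivative velocity A (\<lambda>s. \<phi> s x) t D) (at t within {0..1})"
proof -
  define C where "C = chart_at A x"
  have C: "C \<in> A" "x \<in> cdom C" unfolding C_def by (rule chart_at)+
  define y where "y = coord C x"
  have y: "y \<in> cimage C" "param C y = x" using C by (auto simp: y_def param_coord)
  let ?S = "{(t, y). t \<in> {0..1} \<and> y \<in> cimage C \<and> \<phi> t (param C y) \<in> cdom D}"
  let ?f = "\<lambda>(t, y). coord D (\<phi> t (param C y))"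
  have "(t, y) \<in> ?S" using t x y by simp
  then obtain U G where U: "open U" "(t, y) \<in> U" "\<forall>k. Ck_on k G U" "\<forall>p\<in>U \<inter> ?S. G p = ?f p"
    using smooth_on_flow[OF C(1) D] unfolding smooth_on_def by meson
  have "Ck_on (Suc 0) G U" using U(3) by blast
  then have "(G has_derivative frechet_derivative G (at (t, y))) (at (t, y))"
    using U(2) by (auto simp: frechet_derivative_works[symmetric])
  moreover have "((\<lambda>s. (s, y)) has_vector_derivative (1, 0)) (at t within {0..1})"
    unfolding has_vector_derivative_def by (auto intro!: derivative_eq_intros)
  ultimately have G: "((\<lambda>s. G (s, y)) has_vector_derivative frechet_derivative G (at (t, y)) (1, 0))
      (at t within {0..1})"
    using vector_derivative_diff_chain_within[of "\<lambda>s. (s, y)" "(1,0)" t "{0..1}" G "frechet_derivative G (at (t, y))"]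
    by (simp add: o_def has_derivative_at_withinI)
  have "openin (top_of_set {0..1}) ({0..1} \<inter> (\<lambda>s. \<phi> s x) -` cdom D)"
    using continuous_on_orbit open_cdom[OF D] by (rule continuous_openin_preimage_gen)
  then obtain V where V: "open V" "{0..1} \<inter> (\<lambda>s. \<phi> s x) -` cdom D = {0..1} \<inter> V"
    by (auto simp: openin_open)
  have "open (V \<inter> (\<lambda>s. (s, y)) -` U)"
    using V(1) U(1) by (intro open_Int open_vimage continuous_intros)
  moreover have "t \<in> V" using V(2) t x by blast
  ultimately obtain d where d: "d > 0" "ball t d \<subseteq> V \<inter> (\<lambda>s. (s, y)) -` U"
    using U(2) open_contains_ball by (metis Int_iff vimageI)
  have "((\<lambda>s. coord D (\<phi> s x)) has_vector_derivative frechet_derivative G (at (t, y)) (1, 0))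
      (at t within {0..1})"
    using G unfolding has_vector_derivative_def
  proof (rule has_derivative_transform_within[OF _ d(1) t])
    fix s assume s: "s \<in> {0..1}" "dist s t < d"
    then have sU: "s \<in> V \<inter> (\<lambda>s. (s, y)) -` U"
      using d(2) by (metis dist_commute mem_ball subsetD)
    then have "\<phi> s x \<in> cdom D" using V(2) s(1) by blast
    then show "G (s, y) = coord D (\<phi> s x)"
      using U(4) sU s(1) y by auto
  qed
  then have "((\<lambda>s. coord D (\<phi> s x)) has_vector_derivative
      vector_derivative (\<lambda>s. coord D (\<phi> s x)) (at t within {0..1})) (at t within {0..1})"
    by (metis differentiableI_vector vector_derivative_works)
  then show ?thesis
    using D x by (simp add: velocity_def o_def)
qed

lemma hamilton_equation:
  assumes D: "D \<in> A" and t: "t \<in> {0..1}" and x: "\<phi> t x \<in> cdom D"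
  shows "\<Omega> D (coord D (\<phi> t x)) (velocity A (\<lambda>s. \<phi> s x) t D) v = grad (H\<^sub>C D) (t, coord D (\<phi> t x)) \<bullet> v"
proof -
  let ?y = "coord D (\<phi> t x)"
  have y: "?y \<in> cimage D" using x by blast
  have "((\<lambda>z. H\<^sub>C D (t, z)) has_derivative (\<lambda>v. space_deriv v (H\<^sub>C D) (t, ?y))) (at ?y)"
    by (rule has_derivative_space_deriv[OF smooth_on_H\<^sub>C[OF D] open_cimage[OF D] t y])
  then have "(H t \<circ> param D has_derivative (\<lambda>v. space_deriv v (H\<^sub>C D) (t, ?y))) (at ?y)"
    by (simp add: H\<^sub>C_def o_def)
  from hamiltonian_vector_field_in_chart[OF D x this, of v]
  have "\<Omega> D ?y (velocity A (\<lambda>s. \<phi> s x) t D) v = space_deriv v (H\<^sub>C D) (t, ?y)"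
    using flow t unfolding hamiltonian_flow_def by simp
  then show ?thesis
    using space_deriv_eq_grad[OF smooth_on_H\<^sub>C[OF D] open_cimage[OF D] t y] by simp
qed

lemma flow_in_chart:
  assumes C: "C \<in> A" and U: "U \<subseteq> cimage C" "open U"
    and stay: "\<And>t y. t \<in> {0..1} \<Longrightarrow> y \<in> U \<Longrightarrow> \<phi> t (param C y) \<in> cdom C"
    and ty: "t \<in> {0..1}" "y \<in> U"
  shows "\<Omega> C (\<phi>\<^sub>C C (t, y)) (time_deriv (\<phi>\<^sub>C C) (t, y)) v = grad (H\<^sub>C C) (t, \<phi>\<^sub>C C (t, y)) \<bullet> v"
proof -
  have "time_deriv (\<phi>\<^sub>C C) (t, y) = velocity A (\<lambda>s. \<phi> s (param C y)) t C"
    using C stay[OF ty] by (simp add: time_deriv_def velocity_def \<phi>\<^sub>C_def o_def)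
  then show ?thesis
    using hamilton_equation[OF C ty(1) stay[OF ty], of v] by (simp add: \<phi>\<^sub>C_def)
qed

lemma grad_at_maximum:
  assumes max: "\<And>z. H t z \<le> H t p" and C: "C \<in> A" "p \<in> cdom C" and t: "t \<in> {0..1}"
  shows "grad (H\<^sub>C C) (t, coord C p) = 0"
proof -
  have q: "coord C p \<in> cimage C" using C by blast
  note D = has_derivative_space_deriv[OF smooth_on_H\<^sub>C[OF C(1)] open_cimage[OF C(1)] t q]
  have "(\<lambda>v. space_deriv v (H\<^sub>C C) (t, coord C p)) = (\<lambda>v. 0)"
    by (rule differential_zero_maxmin[OF q open_cimage[OF C(1)] D])
       (use max C in \<open>auto simp: H\<^sub>C_def param_coord\<close>)
  then show ?thesis by (simp add: grad_def fun_eq_iff)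
qed

text \<open>The tube lemma for the compact time interval. It supplies initial points whose orbits stay
  in one chart for all times.\<close>

lemma nearby_orbits_stay_in_open_set:
  assumes N: "open N" and p: "\<And>t. t \<in> {0..1} \<Longrightarrow> \<phi> t p \<in> N"
  shows "\<exists>X. open X \<and> p \<in> X \<and> (\<forall>t\<in>{0..1}. \<forall>x\<in>X. \<phi> t x \<in> N)"
proof -
  have "continuous_on (UNIV \<times> {0..1}) (\<lambda>p :: 'm \<times> real. (snd p, fst p))"
    by (intro continuous_intros)
  from continuous_on_compose2[OF continuous_on_flow this]
  have "continuous_on (UNIV \<times> {0..1}) (\<lambda>(x, t). \<phi> t x)"
    unfolding split_beta by force
  then have "openin (top_of_set (UNIV \<times> {0..1})) ((UNIV \<times> {0..1}) \<inter> (\<lambda>(x, t). \<phi> t x) -` N)"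
    using N by (rule continuous_openin_preimage_gen)
  then obtain W where W: "open W" "(UNIV \<times> {0..1}) \<inter> (\<lambda>(x, t). \<phi> t x) -` N = (UNIV \<times> {0..1}) \<inter> W"
    by (auto simp: openin_open)
  have "{p} \<times> {0..1} \<subseteq> W" using p W(2) by auto
  with W(1) obtain X where "p \<in> X" "open X" "X \<times> {0..1} \<subseteq> W"
    using Elementary_Topology.tube_lemma[OF compact_Icc] by metis
  then show ?thesis using W(2) by (intro exI[of _ X]) auto
qed


text \<open>At a fixed global maximum the Hamiltonian vector field vanishes at all times, and uniqueness of
  solutions forces the orbit to be constant. In a chart the speed is bounded by \<open>L\<close> times the
  distance to the maximum; over a time \<open>1 / (2 L)\<close> this bounds the largest distance by half of itself.
  The times at which the orbit is at the maximum are therefore open in \<open>[0,1]\<close>, as well as closed.\<close>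

lemma maximum_is_fixed:
  assumes max: "fixed_global_maximum H p" and t: "t \<in> {0..1}"
  shows "\<phi> t p = p"
proof -
  define C where "C = chart_at A p"
  have C: "C \<in> A" "p \<in> cdom C" unfolding C_def by (rule chart_at)+
  define q where "q = coord C p"
  have q: "q \<in> cimage C" "param C q = p" using C by (auto simp: q_def param_coord)
  interpret closed_form_on_open "cimage C" "\<Omega> C" "\<lambda>y w u v. frechet_derivative (\<lambda>z. \<Omega> C z u v) (at y) w"
    by (rule closed_form_in_chart[OF C(1)])
  obtain \<rho> where \<rho>: "\<rho> > 0" "cball q \<rho> \<subseteq> cimage C"
    using open_dom q(1) open_contains_cball by blast
  obtain m where m: "m > 0" "\<And>y u a. y \<in> cball q \<rho> \<Longrightarrow> (\<And>v. \<Omega> C y u v = a \<bullet> v) \<Longrightarrow> norm u \<le> m * norm a"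
  proof -
    have "\<exists>m>0. \<forall>y\<in>cball q \<rho>. \<forall>u a. (\<forall>v. \<Omega> C y u v = a \<bullet> v) \<longrightarrow> norm u \<le> m * norm a"
      by (rule nondegenerate_on_compact[OF compact_cball \<rho>(2)])
         (rule form_nondegenerate[OF C(1) subsetD[OF \<rho>(2)]])
    then show thesis using that by blast
  qed
  obtain \<eta> where \<eta>: "\<eta> \<ge> 0" "\<forall>t\<in>{0..1}. \<forall>y\<in>cball q \<rho>. \<forall>i\<in>Basis. \<forall>j\<in>Basis.
      \<bar>space_deriv j (space_deriv i (H\<^sub>C C)) (t, y)\<bar> \<le> \<eta>"
    using second_deriv_bounded[OF smooth_on_H\<^sub>C[OF C(1)] open_dom compact_cball \<rho>(2)] by blast
  define L where "L = m * (real DIM('e) * (real DIM('e) * \<eta>)) + 1"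
  have "L > 0" using m(1) \<eta>(1) unfolding L_def by (auto intro!: add_nonneg_pos)
  have speed: "norm (velocity A (\<lambda>s. \<phi> s p) s C) \<le> L * norm (coord C (\<phi> s p) - q)"
    if s: "s \<in> {0..1}" and x: "\<phi> s p \<in> cdom C" "coord C (\<phi> s p) \<in> cball q \<rho>" for s
  proof -
    let ?y = "coord C (\<phi> s p)"
    have "norm (velocity A (\<lambda>s. \<phi> s p) s C) \<le> m * norm (grad (H\<^sub>C C) (s, ?y))"
      by (rule m(2)[OF x(2)]) (rule hamilton_equation[OF C(1) s x(1)])
    also have "norm (grad (H\<^sub>C C) (s, ?y)) = norm (grad (H\<^sub>C C) (s, ?y) - grad (H\<^sub>C C) (s, q))"
      using grad_at_maximum[OF _ C s] max s by (simp add: q_def fixed_global_maximum_def)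
    also have "\<dots> \<le> real DIM('e) * (real DIM('e) * \<eta>) * norm (?y - q)"
      by (rule grad_lipschitz[OF smooth_on_H\<^sub>C[OF C(1)] open_dom s convex_cball \<rho>(2)])
         (use \<eta> s x \<rho> in auto)
    also have "m * \<dots> \<le> L * norm (?y - q)"
      by (simp add: L_def algebra_simps)
    finally show ?thesis using m(1) by simp
  qed
  have locally_fixed: "\<exists>d>0. \<forall>s\<in>{0..1}. dist s t\<^sub>1 < d \<longrightarrow> \<phi> s p = p"
    if t1: "t\<^sub>1 \<in> {0..1}" "\<phi> t\<^sub>1 p = p" for t\<^sub>1
  proof -
    have N: "open (param C ` ball q \<rho>)"
      using \<rho> by (intro open_param_image[OF C(1)]) auto
    have "openin (top_of_set {0..1}) ({0..1} \<inter> (\<lambda>s. \<phi> s p) -` (param C ` ball q \<rho>))"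
      using continuous_on_orbit N by (rule continuous_openin_preimage_gen)
    then obtain V where V: "open V" "{0..1} \<inter> (\<lambda>s. \<phi> s p) -` (param C ` ball q \<rho>) = {0..1} \<inter> V"
      by (auto simp: openin_open)
    have "p \<in> param C ` ball q \<rho>" using q(2) \<rho>(1) by (metis centre_in_ball imageI)
    then have "t\<^sub>1 \<in> V" using V(2) t1 by blast
    then obtain e where e: "e > 0" "ball t\<^sub>1 e \<subseteq> V" using V(1) open_contains_ball by blast
    define d where "d = min (e / 2) (1 / (2 * L))"
    have d: "d > 0" "d < e" "L * d \<le> 1 / 2"
      using e \<open>L > 0\<close> by (auto simp: d_def min_def field_simps)
    define S where "S = {0..1} \<inter> cball t\<^sub>1 d"
    have S: "compact S" "convex S" "t\<^sub>1 \<in> S"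
      using t1 d by (auto simp: S_def intro!: compact_Int convex_Int)
    have in_ball: "\<phi> s p \<in> cdom C" "coord C (\<phi> s p) \<in> ball q \<rho>" if "s \<in> S" for s
    proof -
      have "s \<in> V" using that e d by (auto simp: S_def)
      then have "\<phi> s p \<in> param C ` ball q \<rho>" using that V(2) by (auto simp: S_def)
      then obtain y where "y \<in> ball q \<rho>" "\<phi> s p = param C y" by blast
      moreover from this have "y \<in> cimage C" using \<rho> by auto
      ultimately show "\<phi> s p \<in> cdom C" "coord C (\<phi> s p) \<in> ball q \<rho>"
        using param_in[OF C(1)] coord_param[OF C(1)] by auto
    qed
    let ?c = "\<lambda>s. coord C (\<phi> s p)"
    have c': "(?c has_vector_derivative velocity A (\<lambda>s. \<phi> s p) s C) (at s within S)" if "s \<in> S" for s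
      using orbit_has_vector_derivative[OF C(1) _ in_ball(1)[OF that]] that
      by (auto simp: S_def intro: has_vector_derivative_within_subset)
    have "continuous_on S ?c"
      using c' by (meson has_vector_derivative_continuous continuous_on_eq_continuous_within)
    then have "continuous_on S (\<lambda>s. norm (?c s - q))" by (intro continuous_intros)
    then obtain s0 where s0: "s0 \<in> S" "\<And>s. s \<in> S \<Longrightarrow> norm (?c s - q) \<le> norm (?c s0 - q)"
      using continuous_attains_sup[OF S(1)] S(3) by (metis empty_iff)
    let ?M = "norm (?c s0 - q)"
    have "norm (?c s0 - ?c t\<^sub>1) \<le> (L * ?M) * norm (s0 - t\<^sub>1)"
    proof (rule differentiable_bound[OF S(2) _ _ s0(1) S(3), where f="?c"
          and f'="\<lambda>s h. h *\<^sub>R velocity A (\<lambda>s. \<phi> s p) s C"])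
      fix s assume s: "s \<in> S"
      show "(?c has_derivative (\<lambda>h. h *\<^sub>R velocity A (\<lambda>s. \<phi> s p) s C)) (at s within S)"
        using c'[OF s] by (simp add: has_vector_derivative_def)
      have "norm (velocity A (\<lambda>s. \<phi> s p) s C) \<le> L * norm (?c s - q)"
        using speed[of s] s in_ball[OF s] by (auto simp: S_def)
      also have "\<dots> \<le> L * ?M" using s0(2)[OF s] \<open>L > 0\<close> by simp
      finally show "onorm (\<lambda>h. h *\<^sub>R velocity A (\<lambda>s. \<phi> s p) s C) \<le> L * ?M"
        by (intro onorm_le) (simp add: mult.commute mult_left_mono)
    qed
    also have "\<dots> \<le> (L * ?M) * d"
      using s0(1) \<open>L > 0\<close> by (intro mult_left_mono) (auto simp: S_def dist_real_def)
    also have "\<dots> = L * d * ?M" by simp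
    also have "\<dots> \<le> 1 / 2 * ?M" using d(3) by (intro mult_right_mono) auto
    finally have "?M \<le> 1 / 2 * ?M" using t1(2) by (simp add: q_def)
    then have "?M = 0" by simp
    have "\<phi> s p = p" if "s \<in> S" for s
    proof -
      have "?c s = q" using s0(2)[OF that] \<open>?M = 0\<close> by simp
      then show ?thesis using param_coord[OF C(1) in_ball(1)[OF that]] q(2) by simp
    qed
    then show ?thesis
      using d(1) by (intro exI[of _ d]) (auto simp: S_def dist_commute)
  qed
  have "{s \<in> {0..1}. \<phi> s p = p} = {0..1}"
  proof -
    have "closedin (top_of_set {0..1}) {s \<in> {0..1}. \<phi> s p = p}"
      using continuous_on_orbit by (rule continuous_closedin_preimage_constant)
    moreover have "openin (top_of_set {0..1}) {s \<in> {0..1}. \<phi> s p = p}"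
      unfolding openin_euclidean_subtopology_iff using locally_fixed by fast
    moreover have "(0::real) \<in> {s \<in> {0..1}. \<phi> s p = p}" by (simp add: flow_0)
    ultimately show ?thesis
      using connected_clopen[of "{0..1::real}"] by (metis (no_types, lifting) connected_Icc empty_iff)
  qed
  then have "t \<in> {s \<in> {0..1}. \<phi> s p = p}" using t by blast
  then show ?thesis by simp
qed

end

section \<open>Rigidity of Hamiltonian loops at a flat maximum\<close>

locale hamiltonian_loop_on = hamiltonian_flow_on A \<omega> H \<phi>
  for A :: "('m::{t2_space, second_countable_topology}, 'e::euclidean_space) chart set"
    and \<omega> H \<phi> +
  assumes loop: "\<phi> 1 = id"
begin

text \<open>Where the second derivatives of the Hamiltonians vanish at a fixed maximum \<open>p\<close>,
  they are small nearby, uniformly in time, so \<open>gradient_square_le\<close> and nondegeneracy bound the squared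
  speed of nearby orbits by a small multiple of the gap \<open>H t p - H t\<close>. Near \<open>p\<close> the orbits stay in a
  ball of a chart, and they are closed because the flow is a loop. Applying
  \<open>semidefinite_loop_rigidity\<close> to the orbits that start on the segment from \<open>p\<close> to a nearby point
  shows that the gap is zero along them. Their speed is then zero too, so the gap is zero at
  the starting points.\<close>

lemma maximum_set_open_at_flat_point:
  assumes max: "fixed_global_maximum H p" and C: "C \<in> A" "p \<in> cdom C"
    and flat: "\<And>t i j. t \<in> {0..1} \<Longrightarrow> space_deriv j (space_deriv i (H\<^sub>C C)) (t, coord C p) = 0"
  shows "\<exists>N. open N \<and> p \<in> N \<and> (\<forall>z\<in>N. \<forall>t\<in>{0..1}. H t z = H t p)"
proof -
  define q where "q = coord C p"
  have q: "q \<in> cimage C" "param C q = p" using C by (auto simp: q_def param_coord)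
  interpret closed_form_on_open "cimage C" "\<Omega> C" "\<lambda>y w u v. frechet_derivative (\<lambda>z. \<Omega> C z u v) (at y) w"
    by (rule closed_form_in_chart[OF C(1)])
  note HC = smooth_on_H\<^sub>C[OF C(1)]
  obtain \<rho> where \<rho>: "\<rho> > 0" "cball q \<rho> \<subseteq> cimage C"
    using open_dom q(1) open_contains_cball by blast
  obtain m where m: "m > 0" "\<And>y u a. y \<in> cball q \<rho> \<Longrightarrow> (\<And>v. \<Omega> C y u v = a \<bullet> v) \<Longrightarrow> norm u \<le> m * norm a"
  proof -
    have "\<exists>m>0. \<forall>y\<in>cball q \<rho>. \<forall>u a. (\<forall>v. \<Omega> C y u v = a \<bullet> v) \<longrightarrow> norm u \<le> m * norm a"
      by (rule nondegenerate_on_compact[OF compact_cball \<rho>(2)])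
         (rule form_nondegenerate[OF C(1) subsetD[OF \<rho>(2)]])
    then show thesis using that by blast
  qed
  obtain B where B: "B \<ge> 0" "\<And>y u v. y \<in> cball q \<rho> \<Longrightarrow> \<bar>\<Omega> C y u v\<bar> \<le> B * norm u * norm v"
    using form_bounded_on_compact[OF compact_cball \<rho>(2)] by blast
  \<comment> \<open>Chosen such that speed squared \<open>\<le> m\<^sup>2 * 4 * \<epsilon> *\<close> gap meets the threshold \<open>B * c < 1\<close>.\<close>
  define \<epsilon> where "\<epsilon> = 1 / (4 * m\<^sup>2 * (B + 1))"
  have \<epsilon>: "\<epsilon> > 0" using m(1) B(1) by (simp add: \<epsilon>_def)
  have small: "B * (m\<^sup>2 * (4 * \<epsilon>)) < 1"
    using m(1) B(1) by (simp add: \<epsilon>_def divide_simps)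
  \<comment> \<open>A bound on the entries of the Hessian costs a factor \<open>n\<^sup>2\<close> as a Lipschitz constant.\<close>
  define n where "n = real DIM('e)"
  have n: "n > 0" by (simp add: n_def)
  obtain \<delta>0 where \<delta>0: "\<delta>0 > 0" "ball q \<delta>0 \<subseteq> cimage C"
    "\<And>t y i j. t \<in> {0..1} \<Longrightarrow> y \<in> ball q \<delta>0 \<Longrightarrow> i \<in> Basis \<Longrightarrow> j \<in> Basis \<Longrightarrow>
      \<bar>space_deriv j (space_deriv i (H\<^sub>C C)) (t, y)\<bar> \<le> \<epsilon> / (n * n)"
  proof -
    have "\<epsilon> / (n * n) > 0" using \<epsilon> n by simp
    from second_deriv_small[OF HC open_dom q(1) _ this] flat show thesis
      unfolding q_def[symmetric] using that by blast
  qed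
  define \<delta> where "\<delta> = min (\<delta>0 / 2) \<rho>"
  have \<delta>: "\<delta> > 0" "ball q (2 * \<delta>) \<subseteq> ball q \<delta>0" "ball q \<delta> \<subseteq> cball q \<rho>"
    using \<delta>0(1) \<rho>(1) by (auto simp: \<delta>_def)
  have gradient: "(norm (grad (H\<^sub>C C) (t, y)))\<^sup>2 \<le> 4 * \<epsilon> * (H t p - H\<^sub>C C (t, y))"
    if t: "t \<in> {0..1}" and y: "y \<in> ball q \<delta>" for t y
  proof -
    have sub: "ball q (2 * \<delta>) \<subseteq> cimage C" using \<delta>(2) \<delta>0(2) by blast
    have "(norm (- grad (H\<^sub>C C) (t, y)))\<^sup>2 \<le> 4 * \<epsilon> * (H t p - H\<^sub>C C (t, y))"
    proof (rule gradient_square_le[where k="\<lambda>y. H t p - H\<^sub>C C (t, y)" and a="\<lambda>y. - grad (H\<^sub>C C) (t, y)"])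
      fix z assume "z \<in> ball q (2 * \<delta>)"
      then have z: "z \<in> cimage C" using sub by blast
      have "((\<lambda>y. H t p - H\<^sub>C C (t, y)) has_derivative (\<lambda>v. 0 - space_deriv v (H\<^sub>C C) (t, z))) (at z)"
        by (intro has_derivative_diff has_derivative_const has_derivative_space_deriv[OF HC open_dom t z])
      then show "((\<lambda>y. H t p - H\<^sub>C C (t, y)) has_derivative (\<lambda>v. - grad (H\<^sub>C C) (t, z) \<bullet> v)) (at z)"
        by (simp add: space_deriv_eq_grad[OF HC open_dom t z])
      show "0 \<le> H t p - H\<^sub>C C (t, z)"
        using max t by (simp add: fixed_global_maximum_def H\<^sub>C_def)
      fix z' assume "z' \<in> ball q (2 * \<delta>)"
      have "norm (grad (H\<^sub>C C) (t, z) - grad (H\<^sub>C C) (t, z')) \<le> n * (n * (\<epsilon> / (n * n))) * norm (z - z')"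
        unfolding n_def
        by (rule grad_lipschitz[OF HC open_dom t convex_ball \<delta>0(2)])
           (use \<delta>0(3)[OF t] \<delta>(2) \<open>z \<in> ball q (2 * \<delta>)\<close> \<open>z' \<in> ball q (2 * \<delta>)\<close> in \<open>auto simp: n_def\<close>)
      then show "norm (- grad (H\<^sub>C C) (t, z) - - grad (H\<^sub>C C) (t, z')) \<le> \<epsilon> * norm (z - z')"
        using n by (simp add: norm_minus_commute)
    next
      show "- grad (H\<^sub>C C) (t, q) = 0"
        using grad_at_maximum[OF _ C t] max t by (simp add: q_def fixed_global_maximum_def)
    qed (use \<epsilon> y in auto)
    then show ?thesis by simp
  qed
  have ball_sub: "ball q \<delta> \<subseteq> cimage C" using \<delta>(3) \<rho>(2) by blast
  have "open (param C ` ball q \<delta>)"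
    using ball_sub by (intro open_param_image[OF C(1)]) auto
  moreover have "\<phi> t p \<in> param C ` ball q \<delta>" if "t \<in> {0..1}" for t
    using maximum_is_fixed[OF max that] q(2) \<delta>(1) by (metis centre_in_ball imageI)
  ultimately obtain X where X: "open X" "p \<in> X" "\<And>t x. t \<in> {0..1} \<Longrightarrow> x \<in> X \<Longrightarrow> \<phi> t x \<in> param C ` ball q \<delta>"
    using nearby_orbits_stay_in_open_set[of "param C ` ball q \<delta>" p] by blast
  have "open (coord C ` (cdom C \<inter> X))"
    using X(1) open_cdom[OF C(1)] by (intro open_coord_image[OF C(1)]) auto
  moreover have "q \<in> coord C ` (cdom C \<inter> X)" using X(2) C by (auto simp: q_def)
  ultimately obtain \<sigma> where \<sigma>: "\<sigma> > 0" "ball q \<sigma> \<subseteq> coord C ` (cdom C \<inter> X)"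
    unfolding open_contains_ball by blast
  define U where "U = ball q \<sigma>"
  have U: "U \<subseteq> cimage C" "open U" "convex U" "q \<in> U" using \<sigma> by (auto simp: U_def)
  have stay: "\<phi> t (param C y) \<in> cdom C" "\<phi>\<^sub>C C (t, y) \<in> ball q \<delta>" if ty: "t \<in> {0..1}" "y \<in> U" for t y
  proof -
    obtain x where "x \<in> cdom C \<inter> X" "y = coord C x" using ty(2) \<sigma>(2) unfolding U_def by blast
    then have "\<phi> t (param C y) \<in> param C ` ball q \<delta>"
      using X(3)[OF ty(1)] by (simp add: param_coord[OF C(1)])
    then obtain w where w: "w \<in> ball q \<delta>" "\<phi> t (param C y) = param C w" by blast
    moreover have "w \<in> cimage C" using w(1) ball_sub by blast
    ultimately show "\<phi> t (param C y) \<in> cdom C" "\<phi>\<^sub>C C (t, y) \<in> ball q \<delta>"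
      using param_in[OF C(1)] coord_param[OF C(1)] by (auto simp: \<phi>\<^sub>C_def)
  qed
  have FC: "smooth_on ({0..1} \<times> U) (\<phi>\<^sub>C C)"
    by (rule smooth_on_\<phi>\<^sub>C[OF C(1) U(1) stay(1)])
  note TC = smooth_on_time_deriv[OF FC U(2)]
  have at_end: "\<phi>\<^sub>C C (0, y) = y" "\<phi>\<^sub>C C (1, y) = y" if "y \<in> U" for y
    using that U(1) by (auto simp: \<phi>\<^sub>C_def flow_0 loop coord_param[OF C(1)])
  have at_q: "\<phi>\<^sub>C C (t, q) = q" if "t \<in> {0..1}" for t
    using maximum_is_fixed[OF max that] by (simp add: \<phi>\<^sub>C_def q(2)) (simp add: q_def)
  have unchanged: "H\<^sub>C C (t, y) = H t p" if y: "y \<in> U" and t: "t \<in> {0..1}" for t y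
  proof -
    define x where "x = y - q"
    define g where "g = (\<lambda>r t. \<phi>\<^sub>C C (t, q + r *\<^sub>R x))"
    define g\<^sub>r where "g\<^sub>r = (\<lambda>r t. space_deriv x (\<phi>\<^sub>C C) (t, q + r *\<^sub>R x))"
    define g\<^sub>t where "g\<^sub>t = (\<lambda>r t. time_deriv (\<phi>\<^sub>C C) (t, q + r *\<^sub>R x))"
    define g\<^sub>r\<^sub>t where "g\<^sub>r\<^sub>t = (\<lambda>r t. space_deriv x (time_deriv (\<phi>\<^sub>C C)) (t, q + r *\<^sub>R x))"
    have inU: "q + r *\<^sub>R x \<in> U" if "r \<in> {0..1}" for r
    proof -
      have "q + r *\<^sub>R x = (1 - r) *\<^sub>R q + r *\<^sub>R y" by (simp add: x_def algebra_simps)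
      then show ?thesis using that U(3,4) y by (auto intro: convexD)
    qed
    have cont: "continuous_on ({0..1} \<times> {0..1}) (\<lambda>(r, t). F (t, q + r *\<^sub>R x))"
      if "smooth_on ({0..1} \<times> U) F" for F :: "real \<times> 'e \<Rightarrow> 'e"
    proof -
      have "continuous_on ({0..1} \<times> {0..1}) (\<lambda>p. (snd p, q + fst p *\<^sub>R x))"
        by (intro continuous_intros)
      moreover have "(\<lambda>p. (snd p, q + fst p *\<^sub>R x)) ` ({0..1} \<times> {0..1}) \<subseteq> {0..1} \<times> U"
        using inU by auto
      ultimately show ?thesis
        using continuous_on_compose2[OF smooth_on_imp_continuous_on[OF that]] by (simp add: split_beta)
    qed
    interpret loop_family "cimage C" "\<Omega> C" "\<lambda>y w u v. frechet_derivative (\<lambda>z. \<Omega> C z u v) (at y) w"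
      "ball q \<delta>" q x g g\<^sub>r g\<^sub>t g\<^sub>r\<^sub>t
    proof
      show "convex (ball q \<delta>)" "ball q \<delta> \<subseteq> cimage C" using ball_sub by auto
      fix r :: real assume r: "r \<in> {0..1}"
      show "g r 0 = q + r *\<^sub>R x" "g r 1 = q + r *\<^sub>R x"
        unfolding g_def using at_end[OF inU[OF r]] by auto
      show "q + r *\<^sub>R x \<in> ball q \<delta>"
        using stay(2)[OF _ inU[OF r], of 0] at_end[OF inU[OF r]] by simp
      fix t :: real assume t: "t \<in> {0..1}"
      show "g r t \<in> ball q \<delta>" unfolding g_def by (rule stay(2)[OF t inU[OF r]])
      show "((\<lambda>r. g r t) has_vector_derivative g\<^sub>r r t) (at r within {0..1})"
        unfolding g_def g\<^sub>r_def
        by (rule has_vector_derivative_along_line[OF has_derivative_space_deriv[OF FC U(2) t inU[OF r]]])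
      show "((\<lambda>t. g r t) has_vector_derivative g\<^sub>t r t) (at t within {0..1})"
        unfolding g_def g\<^sub>t_def by (rule has_vector_derivative_time_deriv[OF FC U(2) t inU[OF r]])
      show "((\<lambda>r. g\<^sub>t r t) has_vector_derivative g\<^sub>r\<^sub>t r t) (at r within {0..1})"
        unfolding g\<^sub>t_def g\<^sub>r\<^sub>t_def
        by (rule has_vector_derivative_along_line[OF has_derivative_space_deriv[OF TC U(2) t inU[OF r]]])
      show "((\<lambda>t. g\<^sub>r r t) has_vector_derivative g\<^sub>r\<^sub>t r t) (at t within {0..1})"
        using has_vector_derivative_time_deriv[OF smooth_on_space_deriv[OF FC U(2)] U(2) t inU[OF r], of x]
        unfolding g\<^sub>r_def g\<^sub>r\<^sub>t_def time_deriv_space_deriv[OF FC U(2) t inU[OF r]] .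
    next
      fix t :: real assume "t \<in> {0..1}"
      then show "g 0 t = q" using at_q by (simp add: g_def)
    next
      show "continuous_on ({0..1} \<times> {0..1}) (\<lambda>(r, t). g r t)"
        "continuous_on ({0..1} \<times> {0..1}) (\<lambda>(r, t). g\<^sub>r r t)"
        "continuous_on ({0..1} \<times> {0..1}) (\<lambda>(r, t). g\<^sub>t r t)"
        "continuous_on ({0..1} \<times> {0..1}) (\<lambda>(r, t). g\<^sub>r\<^sub>t r t)"
        unfolding g_def g\<^sub>r_def g\<^sub>t_def g\<^sub>r\<^sub>t_def
        by (intro cont FC TC smooth_on_space_deriv U(2))+
    qed
    let ?h = "\<lambda>t y. H\<^sub>C C (t, y) - H t p"
    have in_image: "g r t \<in> cimage C" if "r \<in> {0..1}" "t \<in> {0..1}" for r t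
      using loop_in that W(2) by blast
    have eq: "\<Omega> C (g r t) (g\<^sub>t r t) v = grad (H\<^sub>C C) (t, g r t) \<bullet> v" if "r \<in> {0..1}" "t \<in> {0..1}" for r t v
      unfolding g_def g\<^sub>t_def by (rule flow_in_chart[OF C(1) U(1,2) stay(1) that(2) inU[OF that(1)]])
    have speed: "(norm (g\<^sub>t r t))\<^sup>2 \<le> m\<^sup>2 * (4 * \<epsilon>) * - ?h t (g r t)" if rt: "r \<in> {0..1}" "t \<in> {0..1}" for r t
    proof -
      have b: "g r t \<in> ball q \<delta>" using loop_in rt by blast
      have "norm (g\<^sub>t r t) \<le> m * norm (grad (H\<^sub>C C) (t, g r t))"
        by (rule m(2)) (use b \<delta>(3) eq[OF rt] in auto)
      then have "(norm (g\<^sub>t r t))\<^sup>2 \<le> (m * norm (grad (H\<^sub>C C) (t, g r t)))\<^sup>2"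
        by (intro power_mono) auto
      also have "\<dots> \<le> m\<^sup>2 * (4 * \<epsilon> * (H t p - H\<^sub>C C (t, g r t)))"
        unfolding power_mult_distrib by (intro mult_left_mono gradient rt b) simp
      finally show ?thesis by (simp add: algebra_simps)
    qed
    have zero: "?h t (g r t) = 0" if rt: "r \<in> {0..1}" "t \<in> {0..1}" for r t
    proof (rule semidefinite_loop_rigidity[where h="?h", OF _ B(1) _ _ _ _ speed small rt])
      show "\<bar>\<Omega> C y u v\<bar> \<le> B * norm u * norm v" if "y \<in> ball q \<delta>" for y u v
        using B(2) that \<delta>(3) by blast
      show "(?h t has_derivative \<Omega> C (g r t) (g\<^sub>t r t)) (at (g r t))" if rt: "r \<in> {0..1}" "t \<in> {0..1}" for r t
      proof -
        have "(?h t has_derivative (\<lambda>v. space_deriv v (H\<^sub>C C) (t, g r t) - 0)) (at (g r t))"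
          by (intro has_derivative_diff has_derivative_const
              has_derivative_space_deriv[OF HC open_dom rt(2) in_image[OF rt]])
        moreover have "space_deriv v (H\<^sub>C C) (t, g r t) - 0 = \<Omega> C (g r t) (g\<^sub>t r t) v" for v
          by (simp add: eq[OF rt] space_deriv_eq_grad[OF HC open_dom rt(2) in_image[OF rt]])
        ultimately show ?thesis by (simp only:)
      qed
      show "continuous_on ({0..1} \<times> {0..1}) (\<lambda>(r, t). ?h t (g r t))"
      proof -
        have 1: "continuous_on ({0..1} \<times> {0..1}) (\<lambda>p. (snd p, g (fst p) (snd p)))"
          using continuous_g by (intro continuous_intros) (simp add: split_beta)
        have 2: "continuous_on ({0..1} \<times> {0..1}) (\<lambda>p::real \<times> real. (snd p, q))"
          by (intro continuous_intros)
        have "continuous_on ({0..1} \<times> {0..1}) (\<lambda>p. H\<^sub>C C (snd p, g (fst p) (snd p)) - H\<^sub>C C (snd p, q))"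
          by (intro continuous_on_diff continuous_on_compose2[OF smooth_on_imp_continuous_on[OF HC] 1]
              continuous_on_compose2[OF smooth_on_imp_continuous_on[OF HC] 2])
             (use in_image q(1) in auto)
        moreover have "H\<^sub>C C (t, q) = H t p" for t by (simp add: H\<^sub>C_def q(2))
        ultimately show ?thesis by (simp add: split_beta)
      qed
      show "?h t q = 0" for t by (simp add: H\<^sub>C_def q(2))
      show "?h t (g r t) \<le> 0" if "t \<in> {0..1}" for r t
        using max that by (simp add: fixed_global_maximum_def H\<^sub>C_def)
    qed
    have "g\<^sub>t 1 s = 0" if "s \<in> {0..1}" for s
      using speed[of 1 s] zero[of 1 s] that by simp
    then have "((\<lambda>t. g 1 t) has_derivative (\<lambda>h. 0)) (at s within {0..1})" if "s \<in> {0..1}" for s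
      using g_t[of 1 s] that by (simp add: has_vector_derivative_def)
    then have "g 1 t = g 1 0"
      using t by (intro has_derivative_zero_unique[of "{0..1}" "g 1" t 0]) auto
    then have "g 1 t = y" using loop_start[of 1] by (simp add: x_def)
    then show ?thesis using zero[of 1 t] t by simp
  qed
  show ?thesis
  proof (intro exI conjI ballI)
    show "open (param C ` U)" using U by (intro open_param_image[OF C(1)])
    show "p \<in> param C ` U" using q(2) U(4) by (metis imageI)
    fix z t assume "z \<in> param C ` U" "t \<in> {0..1::real}"
    then show "H t z = H t p" using unchanged by (auto simp: H\<^sub>C_def)
  qed
qed

text \<open>If the linearized flow at \<open>p\<close> is constantly the identity, then its time derivative is zero:
  the linearization of the Hamiltonian vector field at its zero \<open>p\<close> vanishes. Differentiating
  \<open>\<Omega>(X, e\<^sub>i) = \<partial>\<^sub>i H\<close> at \<open>p\<close>, where \<open>X\<close> and its derivative vanish, shows that the Hessian of the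
  Hamiltonian vanishes at \<open>p\<close>.\<close>

lemma flat_of_identity_linearization:
  assumes max: "fixed_global_maximum H p"
    and id: "\<And>t v. t \<in> {0..1} \<Longrightarrow> v \<in> tangent_space A p \<Longrightarrow> tangent_map A (\<phi> t) p v = v"
    and t: "t \<in> {0..1}"
  shows "space_deriv u (space_deriv i (H\<^sub>C (chart_at A p))) (t, coord (chart_at A p) p) = 0"
proof -
  define C where "C = chart_at A p"
  have C: "C \<in> A" "p \<in> cdom C" unfolding C_def by (rule chart_at)+
  define q where "q = coord C p"
  have q: "q \<in> cimage C" "param C q = p" using C by (auto simp: q_def param_coord)
  interpret closed_form_on_open "cimage C" "\<Omega> C" "\<lambda>y w u v. frechet_derivative (\<lambda>z. \<Omega> C z u v) (at y) w"
    by (rule closed_form_in_chart[OF C(1)])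
  note HC = smooth_on_H\<^sub>C[OF C(1)]
  have "\<phi> t p \<in> cdom C" if "t \<in> {0..1}" for t
    using maximum_is_fixed[OF max that] C(2) by simp
  then obtain X where X: "open X" "p \<in> X" "\<And>t x. t \<in> {0..1} \<Longrightarrow> x \<in> X \<Longrightarrow> \<phi> t x \<in> cdom C"
    using nearby_orbits_stay_in_open_set[OF open_cdom[OF C(1)]] by metis
  define U where "U = coord C ` (cdom C \<inter> X)"
  have U: "U \<subseteq> cimage C" "open U" "q \<in> U"
    using X(1,2) open_cdom[OF C(1)] C by (auto simp: U_def q_def intro!: open_coord_image[OF C(1)])
  have stay: "\<phi> t (param C y) \<in> cdom C" if "t \<in> {0..1}" "y \<in> U" for t y
    using X(3)[OF that(1)] that(2) by (auto simp: U_def param_coord[OF C(1)])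
  have FC: "smooth_on ({0..1} \<times> U) (\<phi>\<^sub>C C)"
    by (rule smooth_on_\<phi>\<^sub>C[OF C(1) U(1) stay])
  note TC = smooth_on_time_deriv[OF FC U(2)]
  have at_q: "\<phi>\<^sub>C C (t, q) = q" if "t \<in> {0..1}" for t
    using maximum_is_fixed[OF max that] by (simp add: \<phi>\<^sub>C_def q(2)) (simp add: q_def)
  have D_id: "space_deriv u (\<phi>\<^sub>C C) (t, q) = u" if "t \<in> {0..1}" for t u
  proof -
    have "tangent_map A (\<phi> t) p (coord_vector A C p u) C = u"
      using id[OF that coord_vector_in_tangent_space[OF C]] coord_vector_self[OF C] by simp
    then show ?thesis
      using C maximum_is_fixed[OF max that] coord_vector_self[OF C]
      by (simp add: tangent_map_def Let_def C_def[symmetric] space_deriv_def \<phi>\<^sub>C_def q_def o_def)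
  qed
  have time_const: "time_deriv F (t, q) = 0" if "\<And>s. s \<in> {0..1} \<Longrightarrow> F (s, q) = c" for F :: "real \<times> 'e \<Rightarrow> 'e" and c
  proof -
    have "((\<lambda>s. F (s, q)) has_vector_derivative 0) (at t within {0..1})"
      by (rule has_vector_derivative_transform[OF t _ has_vector_derivative_const]) (use that in simp)
    then show ?thesis
      using t by (simp add: time_deriv_def vector_derivative_within_closed_interval)
  qed
  have still: "time_deriv (\<phi>\<^sub>C C) (t, q) = 0"
    by (rule time_const) (rule at_q)
  have "space_deriv u (time_deriv (\<phi>\<^sub>C C)) (t, q) = 0"
    using time_deriv_space_deriv[OF FC U(2) t U(3), of u] time_const[of "space_deriv u (\<phi>\<^sub>C C)" u] D_id by simp
  then have dT: "((\<lambda>r. time_deriv (\<phi>\<^sub>C C) (t, q + r *\<^sub>R u)) has_vector_derivative 0) (at 0 within S)" for S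
    using has_vector_derivative_along_line[of "\<lambda>y. time_deriv (\<phi>\<^sub>C C) (t, y)" _ q 0 u S]
      has_derivative_space_deriv[OF TC U(2) t U(3)] by fastforce
  have dF: "((\<lambda>r. \<phi>\<^sub>C C (t, q + r *\<^sub>R u)) has_vector_derivative u) (at 0 within S)" for S
    using has_vector_derivative_along_line[of "\<lambda>y. \<phi>\<^sub>C C (t, y)" _ q 0 u S]
      has_derivative_space_deriv[OF FC U(2) t U(3)] D_id[OF t] by fastforce
  define S where "S = (\<lambda>r. q + r *\<^sub>R u) -` U"
  have S: "open S" "0 \<in> S"
    using U(2,3) unfolding S_def by (auto intro!: open_vimage continuous_intros)
  have in_image: "\<phi>\<^sub>C C (t, y) \<in> cimage C" if "y \<in> U" for y
    using stay[OF t that] by (auto simp: \<phi>\<^sub>C_def)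
  have "((\<lambda>r. \<Omega> C (\<phi>\<^sub>C C (t, q + r *\<^sub>R u)) (time_deriv (\<phi>\<^sub>C C) (t, q + r *\<^sub>R u)) i) has_vector_derivative 0)
      (at 0 within S)"
    using has_vector_derivative_form[OF dF dT has_vector_derivative_const S(2), of i]
      in_image at_q[OF t] still q(1) form_deriv_linear[OF q(1)] form_deriv_expand[OF q(1), where w=u and a=0 and b=i]
    by (auto simp: S_def image_subset_iff)
  moreover have "\<Omega> C (\<phi>\<^sub>C C (t, q + r *\<^sub>R u)) (time_deriv (\<phi>\<^sub>C C) (t, q + r *\<^sub>R u)) i
      = space_deriv i (H\<^sub>C C) (t, \<phi>\<^sub>C C (t, q + r *\<^sub>R u))" if "r \<in> S" for r
    using that flow_in_chart[OF C(1) U(1,2) stay t] in_image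
    by (simp add: S_def space_deriv_eq_grad[OF HC open_dom t])
  ultimately have "((\<lambda>r. space_deriv i (H\<^sub>C C) (t, \<phi>\<^sub>C C (t, q + r *\<^sub>R u))) has_vector_derivative 0) (at 0 within S)"
    by (rule has_vector_derivative_transform[OF S(2) sym, rotated])
  moreover have "((\<lambda>r. space_deriv i (H\<^sub>C C) (t, \<phi>\<^sub>C C (t, q + r *\<^sub>R u))) has_vector_derivative
      space_deriv u (space_deriv i (H\<^sub>C C)) (t, q)) (at 0 within S)"
  proof -
    have "((\<lambda>y. space_deriv i (H\<^sub>C C) (t, y)) has_derivative (\<lambda>v. space_deriv v (space_deriv i (H\<^sub>C C)) (t, q)))
        (at (\<phi>\<^sub>C C (t, q + 0 *\<^sub>R u)))"
      using has_derivative_space_deriv[OF smooth_on_space_deriv[OF HC open_dom] open_dom t q(1)] at_q[OF t] by simp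
    from vector_derivative_diff_chain_within[OF dF has_derivative_at_withinI[OF this]]
    show ?thesis by (simp add: o_def)
  qed
  ultimately have "space_deriv u (space_deriv i (H\<^sub>C C)) (t, q) = 0"
    using vector_derivative_unique_at[of _ _ 0] at_within_open[OF S(2,1)] by metis
  then show ?thesis by (simp add: C_def q_def)
qed

text \<open>Let \<open>Z\<close> be the set of points near which \<open>H t\<close> has its maximal value for all
  \<open>t\<close>. It is open by definition. At a point of its closure, \<open>H t\<close> is maximal and its second derivatives
  vanish, both by continuity, so local rigidity puts the point into \<open>Z\<close>. By connectedness every
  point is a fixed global maximum, and hence fixed by the flow.\<close>

lemma trivial_if_flat_maximum:
  assumes max: "fixed_global_maximum H p" and conn: "connected (UNIV :: 'm set)"
    and flat: "\<And>t i j. t \<in> {0..1} \<Longrightarrow>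
      space_deriv j (space_deriv i (H\<^sub>C (chart_at A p))) (t, coord (chart_at A p) p) = 0"
    and t: "t \<in> {0..1}"
  shows "\<phi> t = id"
proof -
  define Z where "Z = {z. \<exists>N. open N \<and> z \<in> N \<and> (\<forall>y\<in>N. \<forall>t\<in>{0..1}. H t y = H t p)}"
  have Z_val: "H t z = H t p" if "z \<in> Z" "t \<in> {0..1}" for z t using that unfolding Z_def by blast
  have to_Z: "z \<in> Z" if val: "\<And>t. t \<in> {0..1} \<Longrightarrow> H t z = H t p"
    and flat: "\<And>t i j. t \<in> {0..1} \<Longrightarrow>
      space_deriv j (space_deriv i (H\<^sub>C (chart_at A z))) (t, coord (chart_at A z) z) = 0" for z
  proof -
    have "fixed_global_maximum H z" using max val by (simp add: fixed_global_maximum_def)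
    from maximum_set_open_at_flat_point[OF this chart_at flat] show ?thesis
      using val unfolding Z_def by force
  qed
  have "open Z"
  proof (subst open_subopen, intro ballI)
    fix z assume "z \<in> Z"
    then obtain N where "open N" "z \<in> N" "\<forall>y\<in>N. \<forall>t\<in>{0..1}. H t y = H t p"
      unfolding Z_def by blast
    moreover from this have "N \<subseteq> Z" unfolding Z_def by blast
    ultimately show "\<exists>T. open T \<and> z \<in> T \<and> T \<subseteq> Z" by blast
  qed
  have "closed Z"
    unfolding closure_subset_eq[symmetric]
  proof
    fix z assume z: "z \<in> closure Z"
    define C where "C = chart_at A z"
    have C: "C \<in> A" "z \<in> cdom C" unfolding C_def by (rule chart_at)+
    have q: "coord C z \<in> cimage C" "param C (coord C z) = z" using C by (auto simp: param_coord)
    have nearby: "\<exists>y\<in>U. param C y \<in> Z" if "open U" "coord C z \<in> U" "U \<subseteq> cimage C" for U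
    proof -
      have "open (param C ` U)" by (rule open_param_image[OF C(1) that(1,3)])
      moreover have "z \<in> param C ` U" using that(2) q(2) by (metis imageI)
      ultimately show ?thesis
        using z unfolding closure_iff_nhds_not_empty by blast
    qed
    have slice: "continuous_on (cimage C) (\<lambda>y. F (t, y))"
      if "smooth_on ({0..1} \<times> cimage C) F" "t \<in> {0..1}" for F :: "real \<times> 'e \<Rightarrow> real" and t
    proof -
      have "continuous_on (cimage C) (\<lambda>y. (t, y))" by (intro continuous_intros)
      then show ?thesis
        by (rule continuous_on_compose2[OF smooth_on_imp_continuous_on[OF that(1)]]) (use that(2) in auto)
    qed
    show "z \<in> Z"
    proof (rule to_Z)
      fix t :: real and i j assume t: "t \<in> {0..1}"
      have "H\<^sub>C C (t, coord C z) = H t p"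
        by (rule constant_on_closure_point[OF slice[OF smooth_on_H\<^sub>C[OF C(1)] t] open_cimage[OF C(1)] q(1)])
           (use nearby Z_val t in \<open>fastforce simp: H\<^sub>C_def\<close>)
      then show "H t z = H t p" by (simp add: H\<^sub>C_def q(2))
      have flat_in_Z: "space_deriv j (space_deriv i (H\<^sub>C C)) (t, y) = 0" if y: "y \<in> cimage C" "param C y \<in> Z" for y
      proof -
        have "open (cdom C \<inter> Z)" using open_cdom[OF C(1)] \<open>open Z\<close> by blast
        then have O: "open (coord C ` (cdom C \<inter> Z))" by (intro open_coord_image[OF C(1)]) auto
        have c: "H\<^sub>C C (t, y') = H t p" if "y' \<in> coord C ` (cdom C \<inter> Z)" for y'
          using that Z_val t by (auto simp: H\<^sub>C_def param_coord[OF C(1)])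
        have "space_deriv i (H\<^sub>C C) (t, y') = 0" if "y' \<in> coord C ` (cdom C \<inter> Z)" for y'
          using space_deriv_eq_zero[OF O that] c by blast
        moreover have "y \<in> coord C ` (cdom C \<inter> Z)"
          using y param_in[OF C(1) y(1)] coord_param[OF C(1) y(1)] by (metis IntI imageI)
        ultimately show ?thesis
          using space_deriv_eq_zero[OF O] by blast
      qed
      have "space_deriv j (space_deriv i (H\<^sub>C C)) (t, coord C z) = 0"
      proof (rule constant_on_closure_point[OF slice[OF _ t] open_cimage[OF C(1)] q(1)])
        show "smooth_on ({0..1} \<times> cimage C) (space_deriv j (space_deriv i (H\<^sub>C C)))"
          by (intro smooth_on_space_deriv smooth_on_H\<^sub>C[OF C(1)] open_cimage[OF C(1)])
        fix U assume "open U" "coord C z \<in> U" "U \<subseteq> cimage C"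
        from nearby[OF this] show "\<exists>y\<in>U. space_deriv j (space_deriv i (H\<^sub>C C)) (t, y) = 0"
          using flat_in_Z \<open>U \<subseteq> cimage C\<close> by blast
      qed
      then show "space_deriv j (space_deriv i (H\<^sub>C (chart_at A z))) (t, coord (chart_at A z) z) = 0"
        by (simp add: C_def)
    qed
  qed
  have "p \<in> Z" using flat by (intro to_Z) auto
  have "Z = UNIV"
    using conn \<open>open Z\<close> \<open>closed Z\<close> \<open>p \<in> Z\<close> unfolding connected_clopen
    by (auto simp flip: open_openin closed_closedin)
  have "\<phi> t z = z" for z
  proof (rule maximum_is_fixed[OF _ t])
    show "fixed_global_maximum H z"
      using max Z_val[of z] \<open>Z = UNIV\<close> by (simp add: fixed_global_maximum_def)
  qed
  then show ?thesis by auto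
qed

end

theorem corollary1p4:
  fixes A :: "('m::{t2_space, second_countable_topology}, 'e::euclidean_space) chart set"
    and \<omega> :: "'m \<Rightarrow> ('m, 'e) tvec \<Rightarrow> ('m, 'e) tvec \<Rightarrow> real"
    and H :: "real \<Rightarrow> 'm \<Rightarrow> real"
    and \<phi> :: "real \<Rightarrow> 'm \<Rightarrow> 'm"
    and x\<^sub>0 :: 'm
  assumes "closed_connected_symplectic_manifold A \<omega>"
    and "smooth_family_functions A H"
    and "hamiltonian_loop A \<omega> H \<phi>"
    and "\<not> \<phi> constant_on {0..1}"
    and "fixed_global_maximum H x\<^sub>0"
  shows "\<exists>t\<in>{0..1}. \<not> (\<forall>v\<in>tangent_space A x\<^sub>0. tangent_map A (\<phi> t) x\<^sub>0 v = v)"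
proof (rule ccontr)
  assume "\<not> ?thesis"
  then have id: "tangent_map A (\<phi> t) x\<^sub>0 v = v" if "t \<in> {0..1}" "v \<in> tangent_space A x\<^sub>0" for t v
    using that by blast
  have conn: "connected (UNIV :: 'm set)"
    using assms(1) unfolding closed_connected_symplectic_manifold_def by blast
  interpret hamiltonian_loop_on A \<omega> H \<phi>
    using assms(1-3) unfolding closed_connected_symplectic_manifold_def hamiltonian_loop_def
    by unfold_locales blast+
  have "\<phi> t = id" if "t \<in> {0..1}" for t
    using assms(5) conn flat_of_identity_linearization[OF assms(5) id] that
    by (rule trivial_if_flat_maximum)
  then have "\<phi> constant_on {0..1}"
    unfolding constant_on_def by blast
  with assms(4) show False ..
qed

end
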